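(* Let $S$ be an idempotent semifield, let $V$ be a free $S$-module of finite rank $n$ with basis $e_1,\dots,e_n$, and let $w\in\bigwedge^d V$ be a nonzero element. Then $w$ satisfies the tropical Plücker relations (i.e. $w$ is a tropical Plücker vector) if and only if the $S$-module $\bigwedge^d Q_w$ is free of rank one.
   Context: An idempotent semifield $S$ is a (commutative) semiring satisfying all axioms of a field except the existence of additive inverses, and such that $s+s=s$ for all $s\in S$; its additive and multiplicative identities are $0$ and $1$. No total order is assumed. For an $S$-module $M$, $M^\vee=\mathrm{Hom}_S(M,S)$. Write $[n]=\{1,\dots,n\}$, $I+j=I\cup\{j\}$, $I-j=I\smallsetminus\{j\}$, and let $x_1,\dots,x_n\in V^\vee$ be the basis dual to $e_1,\dots,e_n$. A congruence on an $S$-module (or $S$-algebra) $M$ is an equivalence relation on $M$ which is a submodule (subalgebra) of $M\times M$. Tropical Grassmann algebra. $\bigwedge V:=\mathrm{Sym}\,V/\langle e_i^2\sim 0\rangle_{i=1}^n$ (quotient by the generated $S$-algebra congruence), graded by $\bigwedge V=\bigoplus_{d\ge 0}\bigwedge^d V$, with (commutative) product denoted $\wedge$. $\bigwedge^dV$ is free with basis $e_I=e_{i_1}\wedge\cdots\wedge e_{i_d}$, $I=\{i_1,\dots,i_d\}\in\binom{[n]}{d}$. Similarly for $V^\vee$ with the basis $x_i$. If $F\twoheadrightarrow M$ is a surjection from a finite rank free module $F$ with basis $f_1,\dots,f_n$, the tropical Grassmann algebra of $M$ relative to this presentation is $\bigwedge M:=\bigwedge F\otimes_{\mathrm{Sym}\,F}\mathrm{Sym}\,M$,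 i.e. the quotient of $\mathrm{Sym}\,M$ by the algebra congruence setting the squares of the images of the $f_i$ to $0$; it is graded, with degree $d$ part $\bigwedge^d M$. Tropical Plücker relations. A nonzero $w=\sum_I w_Ie_I\in\bigwedge^dV$ is a tropical Plücker vector if for all $A\in\binom{[n]}{d+1}$, $B\in\binom{[n]}{d-1}$ and every $p\in A\smallsetminus B$, $\sum_{i\in A\smallsetminus B}w_{A-i}w_{B+i}=\sum_{i\in A\smallsetminus B,\, i\ne p}w_{A-i}w_{B+i}$. Bend relations and $Q_w$. The bend relations of a linear form $f=\sum_i f_ix_i\in V^\vee$ are the relations $f\sim\sum_{i\neq j}f_ix_i$ for $j=1,\dots,n$. For a linear map $\varphi:V\to M$, $\mathcal{B}(\varphi)$ is the $S$-module congruence on $V^\vee$ generated by the bend relations of all $f$ in the image of the dual map $\varphi^\vee:M^\vee\to V^\vee$. Set $Q_w:=V^\vee/\mathcal{B}(-\wedge w)$, where $-\wedge w:V\to\bigwedge^{d+1}V$, and $\bigwedge Q_w$ is taken relative to the presentation $V^\vee\twoheadrightarrow Q_w$ and the basis $x_1,\dots,x_n$. *)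

theory Defs
  imports "HOL-Algebra.Module" "HOL-Library.Multiset" "HOL-Library.Poly_Mapping"
begin

class idempotent_semifield = comm_semiring_1 +
  assumes add_idempotent: "a + a = a"
    and ex_mult_inverse: "a \<noteq> 0 \<Longrightarrow> \<exists>b. a * b = 1"


section \<open>Modules over a commutative semiring\<close>

text \<open>
  The record type \<open>module\<close> of HOL-Algebra is used both for modules and for algebras over a
  semiring given as a type. As in that library, the fields \<open>mult\<close> and \<open>one\<close> of a mere module
  carry no meaning.
\<close>

locale semimodule = abelian_monoid M
  for M :: "('s::comm_semiring_1, 'm, 'r) module_scheme" (structure) +
  assumes smult_closed [simp, intro]: "x \<in> carrier M \<Longrightarrow> a \<odot> x \<in> carrier M"
    and smult_l_distr: "x \<in> carrier M \<Longrightarrow> (a + b) \<odot> x = a \<odot> x \<oplus> b \<odot> x"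
    and smult_r_distr: "\<lbrakk>x \<in> carrier M; y \<in> carrier M\<rbrakk> \<Longrightarrow> a \<odot> (x \<oplus> y) = a \<odot> x \<oplus> a \<odot> y"
    and smult_assoc: "x \<in> carrier M \<Longrightarrow> (a * b) \<odot> x = a \<odot> (b \<odot> x)"
    and smult_one [simp]: "x \<in> carrier M \<Longrightarrow> 1 \<odot> x = x"
    and smult_l_null [simp]: "x \<in> carrier M \<Longrightarrow> 0 \<odot> x = \<zero>"
    and smult_r_null [simp]: "a \<odot> \<zero> = \<zero>"

definition semimodule_hom ::
  "('s, 'a, 'r) module_scheme \<Rightarrow> ('s, 'b, 'q) module_scheme \<Rightarrow> ('a \<Rightarrow> 'b) set" where
  "semimodule_hom M N = {h \<in> carrier M \<rightarrow> carrier N.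
     (\<forall>x\<in>carrier M. \<forall>y\<in>carrier M. h (x \<oplus>\<^bsub>M\<^esub> y) = h x \<oplus>\<^bsub>N\<^esub> h y) \<and>
     (\<forall>a. \<forall>x\<in>carrier M. h (a \<odot>\<^bsub>M\<^esub> x) = a \<odot>\<^bsub>N\<^esub> h x)}"

definition finite_basis ::
  "('s, 'm, 'r) module_scheme \<Rightarrow> 'i set \<Rightarrow> ('i \<Rightarrow> 'm) \<Rightarrow> bool" where
  "finite_basis M I b \<longleftrightarrow> finite I \<and> b \<in> I \<rightarrow> carrier M \<and>
     (\<forall>m\<in>carrier M. \<exists>!c. c \<in> extensional I \<and> m = (\<Oplus>\<^bsub>M\<^esub>i\<in>I. c i \<odot>\<^bsub>M\<^esub> b i))"

definition coords ::
  "('s, 'm, 'r) module_scheme \<Rightarrow> 'i set \<Rightarrow> ('i \<Rightarrow> 'm) \<Rightarrow> 'm \<Rightarrow> 'i \<Rightarrow> 's" where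
  "coords M I b m = (THE c. c \<in> extensional I \<and> m = (\<Oplus>\<^bsub>M\<^esub>i\<in>I. c i \<odot>\<^bsub>M\<^esub> b i))"

definition free_of_rank :: "('s::comm_semiring_1, 'm, 'r) module_scheme \<Rightarrow> nat \<Rightarrow> bool" where
  "free_of_rank M r \<longleftrightarrow> semimodule M \<and> (\<exists>b. finite_basis M {1..r} b)"

definition scalar_module :: "('s::comm_semiring_1, 's) module" where
  "scalar_module = \<lparr>carrier = UNIV, monoid.mult = (*), one = 1, zero = 0, add = (+), smult = (*)\<rparr>"

text \<open>
  Linear forms are taken to be \<open>undefined\<close> off the carrier, so that two of them are equal as soon
  as they agree on the module.
\<close>

definition dual :: "('s::comm_semiring_1, 'm, 'r) module_scheme \<Rightarrow> ('s, 'm \<Rightarrow> 's) module" where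
  "dual M = \<lparr>carrier = semimodule_hom M scalar_module \<inter> extensional (carrier M),
     monoid.mult = undefined, one = undefined,
     zero = (\<lambda>x\<in>carrier M. 0),
     add = (\<lambda>f g. \<lambda>x\<in>carrier M. f x + g x),
     smult = (\<lambda>a f. \<lambda>x\<in>carrier M. a * f x)\<rparr>"

definition dual_map ::
  "('s, 'a, 'r) module_scheme \<Rightarrow> ('a \<Rightarrow> 'b) \<Rightarrow> ('b \<Rightarrow> 's) \<Rightarrow> ('a \<Rightarrow> 's)" where
  "dual_map M \<phi> f = (\<lambda>v\<in>carrier M. f (\<phi> v))"

definition dual_basis ::
  "('s, 'v, 'r) module_scheme \<Rightarrow> nat \<Rightarrow> (nat \<Rightarrow> 'v) \<Rightarrow> nat \<Rightarrow> ('v \<Rightarrow> 's)" where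
  "dual_basis V n e i = (\<lambda>v\<in>carrier V. coords V {1..n} e v i)"


section \<open>Congruences and quotients\<close>

definition module_congruence :: "('s, 'm, 'r) module_scheme \<Rightarrow> ('m \<times> 'm) set \<Rightarrow> bool" where
  "module_congruence M R \<longleftrightarrow> equiv (carrier M) R \<and>
     (\<forall>(x, x')\<in>R. \<forall>(y, y')\<in>R. (x \<oplus>\<^bsub>M\<^esub> y, x' \<oplus>\<^bsub>M\<^esub> y') \<in> R) \<and>
     (\<forall>a. \<forall>(x, x')\<in>R. (a \<odot>\<^bsub>M\<^esub> x, a \<odot>\<^bsub>M\<^esub> x') \<in> R)"

definition algebra_congruence :: "('s, 'm, 'r) module_scheme \<Rightarrow> ('m \<times> 'm) set \<Rightarrow> bool" where
  "algebra_congruence A R \<longleftrightarrow> module_congruence A R \<and>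
     (\<forall>(x, x')\<in>R. \<forall>(y, y')\<in>R. (x \<otimes>\<^bsub>A\<^esub> y, x' \<otimes>\<^bsub>A\<^esub> y') \<in> R)"

definition gen_module_congruence ::
  "('s, 'm, 'r) module_scheme \<Rightarrow> ('m \<times> 'm) set \<Rightarrow> ('m \<times> 'm) set" where
  "gen_module_congruence M G = \<Inter>{R. module_congruence M R \<and> G \<subseteq> R}"

definition gen_algebra_congruence ::
  "('s, 'm, 'r) module_scheme \<Rightarrow> ('m \<times> 'm) set \<Rightarrow> ('m \<times> 'm) set" where
  "gen_algebra_congruence A G = \<Inter>{R. algebra_congruence A R \<and> G \<subseteq> R}"

definition quotient_by ::
  "('s, 'm, 'r) module_scheme \<Rightarrow> ('m \<times> 'm) set \<Rightarrow> ('s, 'm set) module" where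
  "quotient_by M R = \<lparr>carrier = carrier M // R,
     monoid.mult = (\<lambda>X Y. \<Union>x\<in>X. \<Union>y\<in>Y. R `` {x \<otimes>\<^bsub>M\<^esub> y}),
     one = R `` {\<one>\<^bsub>M\<^esub>},
     zero = R `` {\<zero>\<^bsub>M\<^esub>},
     add = (\<lambda>X Y. \<Union>x\<in>X. \<Union>y\<in>Y. R `` {x \<oplus>\<^bsub>M\<^esub> y}),
     smult = (\<lambda>a X. \<Union>x\<in>X. R `` {a \<odot>\<^bsub>M\<^esub> x})\<rparr>"


section \<open>Symmetric algebras\<close>

text \<open>
  \<open>poly_algebra M\<close> is the free commutative algebra on the underlying set of \<open>M\<close>: a monomial is a
  multiset of elements of \<open>M\<close>. The symmetric algebra is its quotient by the relations making the
  map from \<open>M\<close> to the set of variables linear.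
\<close>

definition poly_algebra ::
  "('s::comm_semiring_1, 'm, 'r) module_scheme \<Rightarrow> ('s, 'm multiset \<Rightarrow>\<^sub>0 's) module" where
  "poly_algebra M = \<lparr>carrier = {p. \<forall>k\<in>Poly_Mapping.keys p. set_mset k \<subseteq> carrier M},
     monoid.mult = (*), one = 1, zero = 0, add = (+), smult = (\<lambda>a p. Poly_Mapping.single 0 a * p)\<rparr>"

definition poly_var :: "'m \<Rightarrow> ('m multiset \<Rightarrow>\<^sub>0 's::comm_semiring_1)" where
  "poly_var m = Poly_Mapping.single {#m#} 1"

definition sym_congruence ::
  "('s::comm_semiring_1, 'm, 'r) module_scheme \<Rightarrow>
     (('m multiset \<Rightarrow>\<^sub>0 's) \<times> ('m multiset \<Rightarrow>\<^sub>0 's)) set" where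
  "sym_congruence M = gen_algebra_congruence (poly_algebra M)
     ({(poly_var (x \<oplus>\<^bsub>M\<^esub> y), poly_var x \<oplus>\<^bsub>poly_algebra M\<^esub> poly_var y) | x y.
         x \<in> carrier M \<and> y \<in> carrier M} \<union>
      {(poly_var (a \<odot>\<^bsub>M\<^esub> x), a \<odot>\<^bsub>poly_algebra M\<^esub> poly_var x) | a x. x \<in> carrier M})"

definition Sym ::
  "('s::comm_semiring_1, 'm, 'r) module_scheme \<Rightarrow> ('s, ('m multiset \<Rightarrow>\<^sub>0 's) set) module" where
  "Sym M = quotient_by (poly_algebra M) (sym_congruence M)"

definition sym_of ::
  "('s::comm_semiring_1, 'm, 'r) module_scheme \<Rightarrow> 'm \<Rightarrow> ('m multiset \<Rightarrow>\<^sub>0 's) set" where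
  "sym_of M m = sym_congruence M `` {poly_var m}"

definition sym_degree ::
  "('s::comm_semiring_1, 'm, 'r) module_scheme \<Rightarrow> nat \<Rightarrow> ('m multiset \<Rightarrow>\<^sub>0 's) set set" where
  "sym_degree M d = (\<lambda>p. sym_congruence M `` {p}) `
     {p \<in> carrier (poly_algebra M). \<forall>k\<in>Poly_Mapping.keys p. size k = d}"


section \<open>Tropical Grassmann algebras\<close>

text \<open>
  A presentation of \<open>M\<close> by a free module of rank \<open>n\<close> enters only through the images
  \<open>g 1, \<dots>, g n\<close> of the basis vectors. For a free module with basis \<open>e\<close>, presented by itself, one
  takes \<open>g = e\<close>.
\<close>

definition grassmann_congruence ::
  "('s::comm_semiring_1, 'm, 'r) module_scheme \<Rightarrow> nat \<Rightarrow> (nat \<Rightarrow> 'm) \<Rightarrow>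
     (('m multiset \<Rightarrow>\<^sub>0 's) set \<times> ('m multiset \<Rightarrow>\<^sub>0 's) set) set" where
  "grassmann_congruence M n g = gen_algebra_congruence (Sym M)
     {(sym_of M (g i) \<otimes>\<^bsub>Sym M\<^esub> sym_of M (g i), \<zero>\<^bsub>Sym M\<^esub>) | i. i \<in> {1..n}}"

definition Grassmann ::
  "('s::comm_semiring_1, 'm, 'r) module_scheme \<Rightarrow> nat \<Rightarrow> (nat \<Rightarrow> 'm) \<Rightarrow>
     ('s, ('m multiset \<Rightarrow>\<^sub>0 's) set set) module" where
  "Grassmann M n g = quotient_by (Sym M) (grassmann_congruence M n g)"

definition grassmann_of ::
  "('s::comm_semiring_1, 'm, 'r) module_scheme \<Rightarrow> nat \<Rightarrow> (nat \<Rightarrow> 'm) \<Rightarrow> 'm \<Rightarrow>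
     ('m multiset \<Rightarrow>\<^sub>0 's) set set" where
  "grassmann_of M n g m = grassmann_congruence M n g `` {sym_of M m}"

definition ext_power ::
  "('s::comm_semiring_1, 'm, 'r) module_scheme \<Rightarrow> nat \<Rightarrow> (nat \<Rightarrow> 'm) \<Rightarrow> nat \<Rightarrow>
     ('s, ('m multiset \<Rightarrow>\<^sub>0 's) set set) module" where
  "ext_power M n g d = (Grassmann M n g)
     \<lparr>carrier := (\<lambda>X. grassmann_congruence M n g `` {X}) ` sym_degree M d\<rparr>"

definition wedge_monomial ::
  "('s::comm_semiring_1, 'm, 'r) module_scheme \<Rightarrow> nat \<Rightarrow> (nat \<Rightarrow> 'm) \<Rightarrow> nat set \<Rightarrow>
     ('m multiset \<Rightarrow>\<^sub>0 's) set set" where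
  "wedge_monomial M n g I = (\<Otimes>\<^bsub>Grassmann M n g\<^esub>i\<in>I. grassmann_of M n g (g i))"

definition wedge_coeff ::
  "('s::comm_semiring_1, 'v, 'r) module_scheme \<Rightarrow> nat \<Rightarrow> (nat \<Rightarrow> 'v) \<Rightarrow> nat \<Rightarrow>
     ('v multiset \<Rightarrow>\<^sub>0 's) set set \<Rightarrow> nat set \<Rightarrow> 's" where
  "wedge_coeff V n e d =
     coords (ext_power V n e d) {I. I \<subseteq> {1..n} \<and> card I = d} (wedge_monomial V n e)"


section \<open>Tropical Pluecker vectors and the module \<open>Q\<^sub>w\<close>\<close>

text \<open>
  The size condition on \<open>B\<close> is \<open>card B = d - 1\<close>, written so that no \<open>B\<close> exists for \<open>d = 0\<close>.
\<close>

definition tropical_pluecker_vector ::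
  "('s::comm_semiring_1, 'v, 'r) module_scheme \<Rightarrow> nat \<Rightarrow> (nat \<Rightarrow> 'v) \<Rightarrow> nat \<Rightarrow>
     ('v multiset \<Rightarrow>\<^sub>0 's) set set \<Rightarrow> bool" where
  "tropical_pluecker_vector V n e d w \<longleftrightarrow>
     w \<in> carrier (ext_power V n e d) \<and> w \<noteq> \<zero>\<^bsub>ext_power V n e d\<^esub> \<and>
     (\<forall>A B. A \<subseteq> {1..n} \<and> card A = d + 1 \<and> B \<subseteq> {1..n} \<and> card B + 1 = d \<longrightarrow>
       (\<forall>p\<in>A - B.
         (\<Sum>i\<in>A - B. wedge_coeff V n e d w (A - {i}) * wedge_coeff V n e d w (B \<union> {i})) =
         (\<Sum>i\<in>A - B - {p}. wedge_coeff V n e d w (A - {i}) * wedge_coeff V n e d w (B \<union> {i}))))"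

text \<open>
  The coefficient \<open>f\<^sub>i\<close> of a linear form \<open>f\<close> in the dual basis is \<open>f (e i)\<close>.
\<close>

definition bend_relations ::
  "('s::comm_semiring_1, 'v, 'r) module_scheme \<Rightarrow> nat \<Rightarrow> (nat \<Rightarrow> 'v) \<Rightarrow> ('v \<Rightarrow> 's) \<Rightarrow>
     (('v \<Rightarrow> 's) \<times> ('v \<Rightarrow> 's)) set" where
  "bend_relations V n e f =
     {(f, \<Oplus>\<^bsub>dual V\<^esub>i\<in>{1..n} - {j}. f (e i) \<odot>\<^bsub>dual V\<^esub> dual_basis V n e i) | j. j \<in> {1..n}}"

definition bend_congruence ::
  "('s::comm_semiring_1, 'v, 'r) module_scheme \<Rightarrow> nat \<Rightarrow> (nat \<Rightarrow> 'v) \<Rightarrow>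
     ('s, 'm, 'q) module_scheme \<Rightarrow> ('v \<Rightarrow> 'm) \<Rightarrow> (('v \<Rightarrow> 's) \<times> ('v \<Rightarrow> 's)) set" where
  "bend_congruence V n e M \<phi> = gen_module_congruence (dual V)
     (\<Union>f\<in>dual_map V \<phi> ` carrier (dual M). bend_relations V n e f)"

definition wedge_map ::
  "('s::comm_semiring_1, 'v, 'r) module_scheme \<Rightarrow> nat \<Rightarrow> (nat \<Rightarrow> 'v) \<Rightarrow>
     ('v multiset \<Rightarrow>\<^sub>0 's) set set \<Rightarrow> 'v \<Rightarrow> ('v multiset \<Rightarrow>\<^sub>0 's) set set" where
  "wedge_map V n e w v = grassmann_of V n e v \<otimes>\<^bsub>Grassmann V n e\<^esub> w"

definition Q_congruence ::
  "('s::comm_semiring_1, 'v, 'r) module_scheme \<Rightarrow> nat \<Rightarrow> (nat \<Rightarrow> 'v) \<Rightarrow> nat \<Rightarrow>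
     ('v multiset \<Rightarrow>\<^sub>0 's) set set \<Rightarrow> (('v \<Rightarrow> 's) \<times> ('v \<Rightarrow> 's)) set" where
  "Q_congruence V n e d w = bend_congruence V n e (ext_power V n e (d + 1)) (wedge_map V n e w)"

definition Q_module ::
  "('s::comm_semiring_1, 'v, 'r) module_scheme \<Rightarrow> nat \<Rightarrow> (nat \<Rightarrow> 'v) \<Rightarrow> nat \<Rightarrow>
     ('v multiset \<Rightarrow>\<^sub>0 's) set set \<Rightarrow> ('s, ('v \<Rightarrow> 's) set) module" where
  "Q_module V n e d w = quotient_by (dual V) (Q_congruence V n e d w)"

definition Q_gen ::
  "('s::comm_semiring_1, 'v, 'r) module_scheme \<Rightarrow> nat \<Rightarrow> (nat \<Rightarrow> 'v) \<Rightarrow> nat \<Rightarrow>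
     ('v multiset \<Rightarrow>\<^sub>0 's) set set \<Rightarrow> nat \<Rightarrow> ('v \<Rightarrow> 's) set" where
  "Q_gen V n e d w i = Q_congruence V n e d w `` {dual_basis V n e i}"

end

theory Submission
  imports Defs
begin

text \<open>
  For a subset \<open>I\<close> of size \<open>d\<close> let \<open>x\<^sub>I\<close> be the class of the squarefree monomial of \<open>I\<close> in
  \<open>\<And>\<^sup>d Q\<^sub>w\<close>. The bend relations come from the linear forms with coefficients \<open>w\<^sub>A\<^sub>-\<^sub>i\<close>, where \<open>A\<close>
  has \<open>d + 1\<close> elements. Multiplied by the monomial of a set \<open>B\<close> with \<open>d - 1\<close> elements, they say
  that in the sum of the \<open>w\<^sub>A\<^sub>-\<^sub>i x\<^sub>B\<^sub>+\<^sub>i\<close> over \<open>i \<in> A - B\<close> any single term may be dropped. These are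
  the Pluecker relations with the second factor left free. Thus a vector \<open>u\<close> is the list of values
  of a linear functional on \<open>\<And>\<^sup>d Q\<^sub>w\<close> if and only if it satisfies the Pluecker relations against
  \<open>w\<close> (\<open>exchange_relations\<close>), and \<open>w\<close> is a Pluecker vector if and only if it is itself such a
  functional.

  Two observations give the theorem. If \<open>I\<close> and \<open>J\<close> differ by the exchange of one element, one of the
  relations has only the two terms \<open>w\<^sub>I x\<^sub>J\<close> and \<open>w\<^sub>J x\<^sub>I\<close>, so these are equal
  (\<open>adjacent_proportional\<close>). And if \<open>u\<close> is a functional with \<open>w\<^sub>I \<noteq> 0\<close> and \<open>u\<^sub>J \<noteq> 0\<close>, the argument of
  the basis exchange axiom leads from \<open>I\<close> to \<open>J\<close> through the support of \<open>w\<close> by exchanges of single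
  elements (\<open>exchange_chain\<close>), so that \<open>w\<^sub>I x\<^sub>J = w\<^sub>J x\<^sub>I\<close> again.

  If \<open>\<And>\<^sup>d Q\<^sub>w\<close> is free of rank one, its coordinate function is a nonzero functional \<open>u\<close>. By the
  second observation \<open>u\<close> is an invertible multiple of \<open>w\<close>, and so \<open>w\<close> satisfies the Pluecker
  relations (\<open>exchange_relations_if_functional\<close>). Conversely, let \<open>w\<close> be a Pluecker vector and
  \<open>w\<^sub>I \<noteq> 0\<close>. The second observation with \<open>u = w\<close> shows that \<open>x\<^sub>J\<close> is the multiple \<open>w\<^sub>J / w\<^sub>I\<close> of
  \<open>x\<^sub>I\<close> if \<open>w\<^sub>J \<noteq> 0\<close>, and \<open>x\<^sub>J = 0\<close> if \<open>w\<^sub>J = 0\<close> by \<open>gmono_nonbasis\<close>; so \<open>x\<^sub>I\<close> spans. It is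
  free because the functional given by \<open>w\<close> takes the invertible value \<open>w\<^sub>I\<close> on it.

  The remaining work is to handle the algebras. A Grassmann algebra is treated as the quotient of a
  polynomial algebra by one congruence \<open>\<approx>\<close>, which is the least one with the required relations
  (\<open>geq_least\<close>). Squarefree monomials span it (\<open>homogeneous_in_span\<close>). Functionals on it are
  produced from a functional on polynomials that vanishes on nonsquarefree monomials: the largest
  algebra congruence on whose classes that functional is constant only has to be checked to contain
  the relations (\<open>alternating_functional\<close>). This is done for a free module, where it shows that the
  squarefree monomials form a basis, and for \<open>Q\<^sub>w\<close>, where it is equivalent to the Pluecker relations.
\<close>

section \<open>Congruences and quotients\<close>

lemma semimoduleI:
  fixes M :: "('s::comm_semiring_1, 'm, 'r) module_scheme" (structure)
  assumes "\<And>x y. \<lbrakk>x \<in> carrier M; y \<in> carrier M\<rbrakk> \<Longrightarrow> x \<oplus> y \<in> carrier M"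
    and "\<zero> \<in> carrier M"
    and "\<And>x y z. \<lbrakk>x \<in> carrier M; y \<in> carrier M; z \<in> carrier M\<rbrakk> \<Longrightarrow> (x \<oplus> y) \<oplus> z = x \<oplus> (y \<oplus> z)"
    and "\<And>x. x \<in> carrier M \<Longrightarrow> \<zero> \<oplus> x = x"
    and "\<And>x y. \<lbrakk>x \<in> carrier M; y \<in> carrier M\<rbrakk> \<Longrightarrow> x \<oplus> y = y \<oplus> x"
    and "\<And>a x. x \<in> carrier M \<Longrightarrow> a \<odot> x \<in> carrier M"
    and "\<And>a b x. x \<in> carrier M \<Longrightarrow> (a + b) \<odot> x = a \<odot> x \<oplus> b \<odot> x"
    and "\<And>a x y. \<lbrakk>x \<in> carrier M; y \<in> carrier M\<rbrakk> \<Longrightarrow> a \<odot> (x \<oplus> y) = a \<odot> x \<oplus> a \<odot> y"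
    and "\<And>a b x. x \<in> carrier M \<Longrightarrow> (a * b) \<odot> x = a \<odot> (b \<odot> x)"
    and "\<And>x. x \<in> carrier M \<Longrightarrow> 1 \<odot> x = x"
    and "\<And>x. x \<in> carrier M \<Longrightarrow> 0 \<odot> x = \<zero>"
    and "\<And>a. a \<odot> \<zero> = \<zero>"
  shows "semimodule M"
  using assms by (auto intro!: semimodule.intro abelian_monoidI semimodule_axioms.intro)

lemma module_congruenceD:
  assumes "module_congruence M R"
  shows module_congruence_equiv: "equiv (carrier M) R"
    and module_congruence_add:
      "\<And>x x' y y'. (x, x') \<in> R \<Longrightarrow> (y, y') \<in> R \<Longrightarrow> (x \<oplus>\<^bsub>M\<^esub> y, x' \<oplus>\<^bsub>M\<^esub> y') \<in> R"
    and module_congruence_smult: "\<And>a x x'. (x, x') \<in> R \<Longrightarrow> (a \<odot>\<^bsub>M\<^esub> x, a \<odot>\<^bsub>M\<^esub> x') \<in> R"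
  using assms unfolding module_congruence_def by fast+

lemma algebra_congruenceD:
  assumes "algebra_congruence M R"
  shows algebra_congruence_module: "module_congruence M R"
    and algebra_congruence_mult:
      "\<And>x x' y y'. (x, x') \<in> R \<Longrightarrow> (y, y') \<in> R \<Longrightarrow> (x \<otimes>\<^bsub>M\<^esub> y, x' \<otimes>\<^bsub>M\<^esub> y') \<in> R"
  using assms unfolding algebra_congruence_def by fast+

lemma module_congruenceI:
  assumes "equiv (carrier M) R"
    and "\<And>x x' y y'. (x, x') \<in> R \<Longrightarrow> (y, y') \<in> R \<Longrightarrow> (x \<oplus>\<^bsub>M\<^esub> y, x' \<oplus>\<^bsub>M\<^esub> y') \<in> R"
    and "\<And>a x x'. (x, x') \<in> R \<Longrightarrow> (a \<odot>\<^bsub>M\<^esub> x, a \<odot>\<^bsub>M\<^esub> x') \<in> R"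
  shows "module_congruence M R"
  using assms unfolding module_congruence_def by auto

lemma algebra_congruenceI:
  assumes "module_congruence M R"
    and "\<And>x x' y y'. (x, x') \<in> R \<Longrightarrow> (y, y') \<in> R \<Longrightarrow> (x \<otimes>\<^bsub>M\<^esub> y, x' \<otimes>\<^bsub>M\<^esub> y') \<in> R"
  shows "algebra_congruence M R"
  using assms unfolding algebra_congruence_def by auto

lemma equiv_Inter:
  assumes "\<R> \<noteq> {}" and "\<And>R. R \<in> \<R> \<Longrightarrow> equiv A R"
  shows "equiv A (\<Inter>\<R>)"
proof (rule equivI)
  show "\<Inter>\<R> \<subseteq> A \<times> A" using assms unfolding equiv_def by blast
  show "refl_on A (\<Inter>\<R>)" using assms unfolding equiv_def refl_on_def by blast
  show "sym (\<Inter>\<R>)" using assms unfolding equiv_def sym_def by blast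
  show "trans (\<Inter>\<R>)" using assms unfolding equiv_def trans_def by blast
qed

lemma equiv_total: "equiv A (A \<times> A)"
  by (auto intro!: equivI refl_onI symI transI)

text \<open>
  A generated congruence is an intersection, and the family intersected could be empty; it contains
  the total relation as soon as the generators are pairs of elements of the carrier.
\<close>

lemma gen_module_congruence:
  assumes M: "semimodule M" and G: "G \<subseteq> carrier M \<times> carrier M"
  shows "module_congruence M (gen_module_congruence M G)"
proof -
  interpret semimodule M by (rule M)
  let ?\<R> = "{R. module_congruence M R \<and> G \<subseteq> R}"
  have "module_congruence M (carrier M \<times> carrier M)"
    by (rule module_congruenceI) (auto simp: equiv_total)
  then have "?\<R> \<noteq> {}" using G by blast
  then have "equiv (carrier M) (\<Inter>?\<R>)"
    by (rule equiv_Inter) (auto dest: module_congruence_equiv)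
  then show ?thesis unfolding gen_module_congruence_def
    by (rule module_congruenceI) (auto intro: module_congruence_add module_congruence_smult)
qed

lemma gen_algebra_congruence:
  assumes A: "semimodule A" "comm_monoid A" and G: "G \<subseteq> carrier A \<times> carrier A"
  shows "algebra_congruence A (gen_algebra_congruence A G)"
proof -
  interpret semimodule A by (rule A)
  interpret mul: comm_monoid A by (rule A)
  let ?\<R> = "{R. algebra_congruence A R \<and> G \<subseteq> R}"
  have "algebra_congruence A (carrier A \<times> carrier A)"
    by (intro algebra_congruenceI module_congruenceI) (auto simp: equiv_total)
  then have "?\<R> \<noteq> {}" using G by blast
  then have "equiv (carrier A) (\<Inter>?\<R>)"
    by (rule equiv_Inter) (auto dest: algebra_congruence_module module_congruence_equiv)
  then show ?thesis unfolding gen_algebra_congruence_def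
    by (intro algebra_congruenceI module_congruenceI)
      (auto intro: module_congruence_add module_congruence_smult algebra_congruence_mult
        dest: algebra_congruence_module)
qed

lemma gen_module_congruence_incl: "G \<subseteq> gen_module_congruence M G"
  unfolding gen_module_congruence_def by blast

lemma gen_algebra_congruence_incl: "G \<subseteq> gen_algebra_congruence A G"
  unfolding gen_algebra_congruence_def by blast

lemma gen_module_congruence_least:
  "module_congruence M R \<Longrightarrow> G \<subseteq> R \<Longrightarrow> gen_module_congruence M G \<subseteq> R"
  unfolding gen_module_congruence_def by blast

lemma gen_algebra_congruence_least:
  "algebra_congruence A R \<Longrightarrow> G \<subseteq> R \<Longrightarrow> gen_algebra_congruence A G \<subseteq> R"
  unfolding gen_algebra_congruence_def by blast

lemma quotient_by_simps:
  "carrier (quotient_by M R) = carrier M // R"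
  "\<zero>\<^bsub>quotient_by M R\<^esub> = R `` {\<zero>\<^bsub>M\<^esub>}"
  "\<one>\<^bsub>quotient_by M R\<^esub> = R `` {\<one>\<^bsub>M\<^esub>}"
  by (simp_all add: quotient_by_def)

lemma quotient_by_add:
  assumes R: "module_congruence M R" and "x \<in> carrier M" "y \<in> carrier M"
  shows "R `` {x} \<oplus>\<^bsub>quotient_by M R\<^esub> R `` {y} = R `` {x \<oplus>\<^bsub>M\<^esub> y}"
proof -
  have "congruent2 R R (\<lambda>x y. R `` {x \<oplus>\<^bsub>M\<^esub> y})"
    by (auto intro!: congruent2I' equiv_class_eq[OF module_congruence_equiv[OF R]]
      module_congruence_add[OF R])
  then show ?thesis unfolding quotient_by_def
    using UN_equiv_class2 module_congruence_equiv[OF R] assms by fastforce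
qed

lemma quotient_by_mult:
  assumes R: "algebra_congruence M R" and "x \<in> carrier M" "y \<in> carrier M"
  shows "R `` {x} \<otimes>\<^bsub>quotient_by M R\<^esub> R `` {y} = R `` {x \<otimes>\<^bsub>M\<^esub> y}"
proof -
  note R' = algebra_congruence_module[OF R]
  have "congruent2 R R (\<lambda>x y. R `` {x \<otimes>\<^bsub>M\<^esub> y})"
    by (auto intro!: congruent2I' equiv_class_eq[OF module_congruence_equiv[OF R']]
      algebra_congruence_mult[OF R])
  then show ?thesis unfolding quotient_by_def
    using UN_equiv_class2 module_congruence_equiv[OF R'] assms by fastforce
qed

lemma quotient_by_smult:
  assumes R: "module_congruence M R" and "x \<in> carrier M"
  shows "a \<odot>\<^bsub>quotient_by M R\<^esub> R `` {x} = R `` {a \<odot>\<^bsub>M\<^esub> x}"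
proof -
  have "congruent R (\<lambda>x. R `` {a \<odot>\<^bsub>M\<^esub> x})"
    by (auto intro!: congruentI equiv_class_eq[OF module_congruence_equiv[OF R]]
      module_congruence_smult[OF R])
  then show ?thesis unfolding quotient_by_def
    using UN_equiv_class module_congruence_equiv[OF R] assms by fastforce
qed

lemma quotient_by_class: "x \<in> carrier M \<Longrightarrow> R `` {x} \<in> carrier (quotient_by M R)"
  by (simp add: quotient_by_simps quotientI)

lemma quotient_by_semimodule:
  assumes M: "semimodule M" and R: "module_congruence M R"
  shows "semimodule (quotient_by M R)"
proof -
  interpret semimodule M by (rule M)
  note [simp] = quotient_by_add[OF R] quotient_by_smult[OF R]
  show ?thesis
    by (rule semimoduleI)
      (auto simp: quotient_by_simps quotientI smult_l_distr smult_r_distr smult_assoc a_ac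
        elim!: quotientE)
qed

lemma quotient_by_comm_monoid:
  assumes M: "comm_monoid M" and R: "algebra_congruence M R"
  shows "comm_monoid (quotient_by M R)"
proof -
  interpret comm_monoid M by (rule M)
  note [simp] = quotient_by_mult[OF R]
  show ?thesis
    by (rule comm_monoidI) (auto simp: quotient_by_simps quotientI m_ac elim!: quotientE)
qed

text \<open>
  Well defined because \<open>R\<close> contains \<open>R0\<close>: a change of representatives stays inside \<open>R\<close>. This makes
  it possible to bound a congruence generated on a quotient by a congruence given before passing to
  the quotient.
\<close>

lemma quotient_by_congruence:
  assumes R0: "algebra_congruence A R0" and R: "algebra_congruence A R" and le: "R0 \<subseteq> R"
  shows "algebra_congruence (quotient_by A R0) {(R0 `` {p}, R0 `` {q}) | p q. (p, q) \<in> R}"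
    (is "algebra_congruence _ ?R'")
proof -
  note R0' = algebra_congruence_module[OF R0] and R' = algebra_congruence_module[OF R]
  note e0 = module_congruence_equiv[OF R0'] and e = module_congruence_equiv[OF R']
  have inC: "p \<in> carrier A" "q \<in> carrier A" if "(p, q) \<in> R" for p q
    using e that by (auto simp: equiv_def)
  have trans: "(p, s) \<in> R" if "(p, q) \<in> R" "(r, s) \<in> R" "R0 `` {q} = R0 `` {r}" for p q r s
  proof -
    have "(q, r) \<in> R0" using that inC e0 by (metis eq_equiv_class_iff)
    then show ?thesis using that le e by (meson equivE subsetD transE)
  qed
  have "equiv (carrier A // R0) ?R'"
  proof (rule equivI)
    show "?R' \<subseteq> carrier A // R0 \<times> carrier A // R0" by (auto simp: quotientI inC)
    show "refl_on (carrier A // R0) ?R'"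
      using e by (auto simp: equiv_def refl_on_def elim!: quotientE)
    show "sym ?R'" using e unfolding equiv_def sym_def by blast
    show "trans ?R'" unfolding trans_def using trans by blast
  qed
  then show ?thesis
  proof (intro algebra_congruenceI module_congruenceI, goal_cases)
    case 1
    then show ?case by (simp add: quotient_by_simps)
  next
    case (2 X X' Y Y')
    then obtain p p' q q' where "(p, p') \<in> R" "(q, q') \<in> R"
      "X = R0 `` {p}" "X' = R0 `` {p'}" "Y = R0 `` {q}" "Y' = R0 `` {q'}" by blast
    then have "X \<oplus>\<^bsub>quotient_by A R0\<^esub> Y = R0 `` {p \<oplus>\<^bsub>A\<^esub> q}"
      "X' \<oplus>\<^bsub>quotient_by A R0\<^esub> Y' = R0 `` {p' \<oplus>\<^bsub>A\<^esub> q'}"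
      "(p \<oplus>\<^bsub>A\<^esub> q, p' \<oplus>\<^bsub>A\<^esub> q') \<in> R"
      using inC by (auto simp: quotient_by_add[OF R0'] intro: module_congruence_add[OF R'])
    then show ?case by blast
  next
    case (3 a X X')
    then obtain p p' where "(p, p') \<in> R" "X = R0 `` {p}" "X' = R0 `` {p'}" by blast
    then have "a \<odot>\<^bsub>quotient_by A R0\<^esub> X = R0 `` {a \<odot>\<^bsub>A\<^esub> p}"
      "a \<odot>\<^bsub>quotient_by A R0\<^esub> X' = R0 `` {a \<odot>\<^bsub>A\<^esub> p'}"
      "(a \<odot>\<^bsub>A\<^esub> p, a \<odot>\<^bsub>A\<^esub> p') \<in> R"
      using inC by (auto simp: quotient_by_smult[OF R0'] intro: module_congruence_smult[OF R'])
    then show ?case by blast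
  next
    case (4 X X' Y Y')
    then obtain p p' q q' where "(p, p') \<in> R" "(q, q') \<in> R"
      "X = R0 `` {p}" "X' = R0 `` {p'}" "Y = R0 `` {q}" "Y' = R0 `` {q'}" by blast
    then have "X \<otimes>\<^bsub>quotient_by A R0\<^esub> Y = R0 `` {p \<otimes>\<^bsub>A\<^esub> q}"
      "X' \<otimes>\<^bsub>quotient_by A R0\<^esub> Y' = R0 `` {p' \<otimes>\<^bsub>A\<^esub> q'}"
      "(p \<otimes>\<^bsub>A\<^esub> q, p' \<otimes>\<^bsub>A\<^esub> q') \<in> R"
      using inC by (auto simp: quotient_by_mult[OF R0] intro: algebra_congruence_mult[OF R])
    then show ?case by blast
  qed
qed

section \<open>Tropical Grassmann algebras as quotients of polynomial algebras\<close>

lemma poly_algebra_simps [simp]: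
  "p \<oplus>\<^bsub>poly_algebra M\<^esub> q = p + q"
  "p \<otimes>\<^bsub>poly_algebra M\<^esub> q = p * q"
  "a \<odot>\<^bsub>poly_algebra M\<^esub> p = Poly_Mapping.single 0 a * p"
  "\<zero>\<^bsub>poly_algebra M\<^esub> = 0"
  "\<one>\<^bsub>poly_algebra M\<^esub> = 1"
  by (simp_all add: poly_algebra_def)

lemma poly_algebra_carrier:
  "p \<in> carrier (poly_algebra M) \<longleftrightarrow> (\<forall>k\<in>Poly_Mapping.keys p. set_mset k \<subseteq> carrier M)"
  by (simp add: poly_algebra_def)

lemma poly_algebra_add [intro]:
  "p \<in> carrier (poly_algebra M) \<Longrightarrow> q \<in> carrier (poly_algebra M) \<Longrightarrow>
    p + q \<in> carrier (poly_algebra M)"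
  unfolding poly_algebra_carrier using keys_add[of p q] by blast

lemma poly_algebra_mult [intro]:
  "p \<in> carrier (poly_algebra M) \<Longrightarrow> q \<in> carrier (poly_algebra M) \<Longrightarrow>
    p * q \<in> carrier (poly_algebra M)"
  unfolding poly_algebra_carrier using keys_mult[of p q] by fastforce

lemma poly_algebra_single [intro]:
  "set_mset k \<subseteq> carrier M \<Longrightarrow> Poly_Mapping.single k a \<in> carrier (poly_algebra M)"
  unfolding poly_algebra_carrier by (simp split: if_splits)

lemma poly_algebra_zero [intro, simp]: "0 \<in> carrier (poly_algebra M)"
  by (simp add: poly_algebra_carrier)

lemma poly_algebra_one [intro, simp]: "1 \<in> carrier (poly_algebra M)"
  by (simp add: poly_algebra_carrier)

lemma poly_algebra_const [intro, simp]: "Poly_Mapping.single 0 a \<in> carrier (poly_algebra M)"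
  by (rule poly_algebra_single) simp

lemma poly_algebra_var [intro]: "x \<in> carrier M \<Longrightarrow> poly_var x \<in> carrier (poly_algebra M)"
  unfolding poly_var_def by (rule poly_algebra_single) simp

lemma poly_algebra_sum [intro]:
  "(\<And>i. i \<in> I \<Longrightarrow> f i \<in> carrier (poly_algebra M)) \<Longrightarrow> sum f I \<in> carrier (poly_algebra M)"
  by (induction I rule: infinite_finite_induct) auto

lemma poly_algebra_prod [intro]:
  "(\<And>i. i \<in> I \<Longrightarrow> f i \<in> carrier (poly_algebra M)) \<Longrightarrow> prod f I \<in> carrier (poly_algebra M)"
  by (induction I rule: infinite_finite_induct) auto

lemma semimodule_poly_algebra: "semimodule (poly_algebra M)"
  by (rule semimoduleI) (auto simp: algebra_simps single_add mult_single)

lemma comm_monoid_poly_algebra: "comm_monoid (poly_algebra M)"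
  by (rule comm_monoidI) (auto simp: mult_ac)

definition homogeneous ::
  "('s::comm_semiring_1, 'm, 'r) module_scheme \<Rightarrow> nat \<Rightarrow> ('m multiset \<Rightarrow>\<^sub>0 's) set" where
  "homogeneous M d =
     {p \<in> carrier (poly_algebra M). \<forall>k\<in>Poly_Mapping.keys p. size k = d}"

lemma homogeneous_carrier: "p \<in> homogeneous M d \<Longrightarrow> p \<in> carrier (poly_algebra M)"
  by (simp add: homogeneous_def)

lemma homogeneous_add [intro]:
  "p \<in> homogeneous M d \<Longrightarrow> q \<in> homogeneous M d \<Longrightarrow> p + q \<in> homogeneous M d"
  using keys_add[of p q] by (auto simp: homogeneous_def)

lemma homogeneous_zero [intro, simp]: "0 \<in> homogeneous M d"
  by (simp add: homogeneous_def)

lemma homogeneous_mult: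
  "p \<in> homogeneous M d \<Longrightarrow> q \<in> homogeneous M d' \<Longrightarrow> p * q \<in> homogeneous M (d + d')"
  using keys_mult[of p q] by (fastforce simp: homogeneous_def)

lemma homogeneous_const [intro, simp]: "Poly_Mapping.single 0 a \<in> homogeneous M 0"
  by (auto simp: homogeneous_def split: if_splits)

lemma homogeneous_smult [intro]:
  "p \<in> homogeneous M d \<Longrightarrow> Poly_Mapping.single 0 a * p \<in> homogeneous M d"
  using homogeneous_mult[OF homogeneous_const] by fastforce

lemma homogeneous_var: "x \<in> carrier M \<Longrightarrow> poly_var x \<in> homogeneous M 1"
  by (auto simp: homogeneous_def poly_var_def split: if_splits)

lemma homogeneous_sum [intro]:
  "(\<And>i. i \<in> I \<Longrightarrow> f i \<in> homogeneous M d) \<Longrightarrow> sum f I \<in> homogeneous M d"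
  by (induction I rule: infinite_finite_induct) auto

lemma homogeneous_prod_var:
  "(\<And>i. i \<in> I \<Longrightarrow> f i \<in> carrier M) \<Longrightarrow> (\<Prod>i\<in>I. poly_var (f i)) \<in> homogeneous M (card I)"
proof (induction I rule: infinite_finite_induct)
  case (insert i I)
  then show ?case using homogeneous_mult[OF homogeneous_var, of "f i" M "\<Prod>i\<in>I. poly_var (f i)"]
    by simp
qed (auto simp flip: single_one)

lemma semimodule_restrict:
  assumes M: "semimodule M" and N: "N \<subseteq> carrier M" "\<zero>\<^bsub>M\<^esub> \<in> N"
    "\<And>x y. x \<in> N \<Longrightarrow> y \<in> N \<Longrightarrow> x \<oplus>\<^bsub>M\<^esub> y \<in> N" "\<And>a x. x \<in> N \<Longrightarrow> a \<odot>\<^bsub>M\<^esub> x \<in> N"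
  shows "semimodule (M\<lparr>carrier := N\<rparr>)"
proof -
  interpret semimodule M by (rule M)
  have N': "x \<in> carrier M" if "x \<in> N" for x using that N by auto
  show ?thesis
    by (rule semimoduleI)
      (auto simp: N N' smult_l_distr smult_r_distr smult_assoc a_assoc intro: a_comm)
qed

text \<open>
  A semimodule with the elements whose squares are to vanish in its Grassmann algebra.
\<close>

locale generated_semimodule = semimodule M
  for M :: "('s::comm_semiring_1, 'm, 'r) module_scheme" (structure) +
  fixes n :: nat and g :: "nat \<Rightarrow> 'm"
  assumes gen_closed: "i \<in> {1..n} \<Longrightarrow> g i \<in> carrier M"
begin

abbreviation Pol :: "('m multiset \<Rightarrow>\<^sub>0 's) set" where
  "Pol \<equiv> carrier (poly_algebra M)"

lemma sym_congruence: "algebra_congruence (poly_algebra M) (sym_congruence M)"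
  unfolding sym_congruence_def
  by (rule gen_algebra_congruence)
    (auto simp: semimodule_poly_algebra comm_monoid_poly_algebra)

lemmas sym_congruence_module = algebra_congruence_module[OF sym_congruence]

lemma semimodule_Sym: "semimodule (Sym M)"
  unfolding Sym_def by (rule quotient_by_semimodule[OF semimodule_poly_algebra sym_congruence_module])

lemma comm_monoid_Sym: "comm_monoid (Sym M)"
  unfolding Sym_def by (rule quotient_by_comm_monoid[OF comm_monoid_poly_algebra sym_congruence])

lemma sym_of_closed: "x \<in> carrier M \<Longrightarrow> sym_of M x \<in> carrier (Sym M)"
  unfolding sym_of_def Sym_def by (auto intro: quotient_by_class)

lemma grassmann_congruence: "algebra_congruence (Sym M) (grassmann_congruence M n g)"
proof -
  interpret S: semimodule "Sym M" by (rule semimodule_Sym)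
  interpret Sm: comm_monoid "Sym M" by (rule comm_monoid_Sym)
  show ?thesis unfolding grassmann_congruence_def
    by (rule gen_algebra_congruence[OF semimodule_Sym comm_monoid_Sym])
      (auto intro!: Sm.m_closed sym_of_closed gen_closed)
qed

lemmas grassmann_congruence_module = algebra_congruence_module[OF grassmann_congruence]

lemma semimodule_Grassmann: "semimodule (Grassmann M n g)"
  unfolding Grassmann_def
  by (rule quotient_by_semimodule[OF semimodule_Sym grassmann_congruence_module])

lemma comm_monoid_Grassmann: "comm_monoid (Grassmann M n g)"
  unfolding Grassmann_def
  by (rule quotient_by_comm_monoid[OF comm_monoid_Sym grassmann_congruence])

text \<open>
  The composite projection from the polynomial algebra, and its kernel. All later computations in
  Grassmann algebras are computations with polynomials modulo this kernel.
\<close>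

definition proj :: "('m multiset \<Rightarrow>\<^sub>0 's) \<Rightarrow> ('m multiset \<Rightarrow>\<^sub>0 's) set set" where
  "proj p = grassmann_congruence M n g `` {sym_congruence M `` {p}}"

definition geq :: "('m multiset \<Rightarrow>\<^sub>0 's) \<Rightarrow> ('m multiset \<Rightarrow>\<^sub>0 's) \<Rightarrow> bool" (infix \<open>\<approx>\<close> 50) where
  "p \<approx> q \<longleftrightarrow> p \<in> Pol \<and> q \<in> Pol \<and> proj p = proj q"

lemma proj_closed: "p \<in> Pol \<Longrightarrow> proj p \<in> carrier (Grassmann M n g)"
  unfolding proj_def Grassmann_def Sym_def by (intro quotient_by_class) auto

lemma proj_add: "p \<in> Pol \<Longrightarrow> q \<in> Pol \<Longrightarrow> proj (p + q) = proj p \<oplus>\<^bsub>Grassmann M n g\<^esub> proj q"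
  unfolding proj_def Grassmann_def
  by (simp add: Sym_def quotient_by_add[OF sym_congruence_module] quotient_by_class
      quotient_by_add[OF grassmann_congruence_module, unfolded Sym_def])

lemma proj_mult: "p \<in> Pol \<Longrightarrow> q \<in> Pol \<Longrightarrow> proj (p * q) = proj p \<otimes>\<^bsub>Grassmann M n g\<^esub> proj q"
  unfolding proj_def Grassmann_def
  by (simp add: Sym_def quotient_by_mult[OF sym_congruence] quotient_by_class
      quotient_by_mult[OF grassmann_congruence, unfolded Sym_def])

lemma proj_smult:
  "p \<in> Pol \<Longrightarrow> proj (Poly_Mapping.single 0 a * p) = a \<odot>\<^bsub>Grassmann M n g\<^esub> proj p"
  unfolding proj_def Grassmann_def
  by (simp add: Sym_def quotient_by_smult[OF sym_congruence_module] quotient_by_class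
      quotient_by_smult[OF grassmann_congruence_module, unfolded Sym_def])

lemma proj_zero: "proj 0 = \<zero>\<^bsub>Grassmann M n g\<^esub>"
  by (simp add: proj_def Grassmann_def Sym_def quotient_by_simps)

lemma proj_one: "proj 1 = \<one>\<^bsub>Grassmann M n g\<^esub>"
  by (simp add: proj_def Grassmann_def Sym_def quotient_by_simps)

lemma grassmann_of_eq: "grassmann_of M n g x = proj (poly_var x)"
  by (simp add: grassmann_of_def proj_def sym_of_def)

lemma geq_refl [intro, simp]: "p \<in> Pol \<Longrightarrow> p \<approx> p"
  by (simp add: geq_def)

lemma geq_sym: "p \<approx> q \<Longrightarrow> q \<approx> p"
  by (simp add: geq_def)

lemma geq_trans [trans]: "p \<approx> q \<Longrightarrow> q \<approx> r \<Longrightarrow> p \<approx> r"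
  by (simp add: geq_def)

lemma geq_Pol: "p \<approx> q \<Longrightarrow> p \<in> Pol" "p \<approx> q \<Longrightarrow> q \<in> Pol"
  by (simp_all add: geq_def)

lemma geq_add: "p \<approx> p' \<Longrightarrow> q \<approx> q' \<Longrightarrow> p + q \<approx> p' + q'"
  by (auto simp: geq_def proj_add)

lemma geq_mult: "p \<approx> p' \<Longrightarrow> q \<approx> q' \<Longrightarrow> p * q \<approx> p' * q'"
  by (auto simp: geq_def proj_mult)

lemma geq_sum: "(\<And>i. i \<in> I \<Longrightarrow> f i \<approx> f' i) \<Longrightarrow> sum f I \<approx> sum f' I"
  by (induction I rule: infinite_finite_induct) (auto intro: geq_add)

lemma geq_if_sym_congruence:
  assumes "(p, q) \<in> sym_congruence M"
  shows "p \<approx> q"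
proof -
  have e: "equiv Pol (sym_congruence M)"
    using module_congruence_equiv[OF sym_congruence_module] .
  then have "p \<in> Pol" "q \<in> Pol" using assms by (auto simp: equiv_def)
  then show ?thesis using equiv_class_eq[OF e assms] by (simp add: geq_def proj_def)
qed

lemma geq_var_add:
  "x \<in> carrier M \<Longrightarrow> y \<in> carrier M \<Longrightarrow> poly_var (x \<oplus> y) \<approx> poly_var x + poly_var y"
  by (rule geq_if_sym_congruence, unfold sym_congruence_def,
      rule subsetD[OF gen_algebra_congruence_incl]) auto

lemma geq_var_smult:
  "x \<in> carrier M \<Longrightarrow> poly_var (a \<odot> x) \<approx> Poly_Mapping.single 0 a * poly_var x"
  by (rule geq_if_sym_congruence, unfold sym_congruence_def,
      rule subsetD[OF gen_algebra_congruence_incl]) auto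

lemma geq_var_zero: "poly_var \<zero> \<approx> 0"
  using geq_var_smult[of \<zero> 0] by simp

lemma geq_gen_square:
  assumes "i \<in> {1..n}"
  shows "poly_var (g i) * poly_var (g i) \<approx> 0"
proof -
  have "(sym_of M (g i) \<otimes>\<^bsub>Sym M\<^esub> sym_of M (g i), \<zero>\<^bsub>Sym M\<^esub>) \<in> grassmann_congruence M n g"
    unfolding grassmann_congruence_def
    by (rule subsetD[OF gen_algebra_congruence_incl]) (use assms in auto)
  then have "(sym_congruence M `` {poly_var (g i) * poly_var (g i)}, sym_congruence M `` {0})
      \<in> grassmann_congruence M n g"
    using assms gen_closed
    by (auto simp: sym_of_def Sym_def quotient_by_mult[OF sym_congruence] poly_algebra_var
        quotient_by_simps)
  then show ?thesis using assms gen_closed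
    by (auto simp: geq_def proj_def poly_algebra_var poly_algebra_mult
      intro!: equiv_class_eq[OF module_congruence_equiv[OF grassmann_congruence_module]])
qed

text \<open>
  The universal property from which functionals on the Grassmann algebra will be obtained. Each of
  the two successive generated congruences is least; the second one lives on the quotient by the
  first, where it is compared with the congruence that \<open>R\<close> induces.
\<close>

lemma geq_least:
  assumes R: "algebra_congruence (poly_algebra M) R"
    and add: "\<And>x y. x \<in> carrier M \<Longrightarrow> y \<in> carrier M \<Longrightarrow>
      (poly_var (x \<oplus> y), poly_var x + poly_var y) \<in> R"
    and smult: "\<And>a x. x \<in> carrier M \<Longrightarrow>
      (poly_var (a \<odot> x), Poly_Mapping.single 0 a * poly_var x) \<in> R"
    and square: "\<And>i. i \<in> {1..n} \<Longrightarrow> (poly_var (g i) * poly_var (g i), 0) \<in> R"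
    and "p \<approx> q"
  shows "(p, q) \<in> R"
proof -
  let ?S = "sym_congruence M"
  let ?R = "{(?S `` {p}, ?S `` {q}) | p q. (p, q) \<in> R}"
  have SR: "?S \<subseteq> R" unfolding sym_congruence_def
    by (rule gen_algebra_congruence_least[OF R]) (use add smult in auto)
  have "algebra_congruence (Sym M) ?R" unfolding Sym_def
    by (rule quotient_by_congruence[OF sym_congruence R SR])
  moreover have "(sym_of M (g i) \<otimes>\<^bsub>Sym M\<^esub> sym_of M (g i), \<zero>\<^bsub>Sym M\<^esub>) \<in> ?R" if "i \<in> {1..n}" for i
    using square[OF that] gen_closed[OF that]
    by (auto simp: sym_of_def Sym_def quotient_by_mult[OF sym_congruence] poly_algebra_var
        quotient_by_simps)
  ultimately have GR: "grassmann_congruence M n g \<subseteq> ?R" unfolding grassmann_congruence_def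
    by (intro gen_algebra_congruence_least) auto
  note eS = module_congruence_equiv[OF sym_congruence_module]
    and eR = module_congruence_equiv[OF algebra_congruence_module[OF R]]
    and eG = module_congruence_equiv[OF grassmann_congruence_module]
  have pq: "p \<in> Pol" "q \<in> Pol" using \<open>p \<approx> q\<close> by (simp_all add: geq_def)
  then have "?S `` {p} \<in> carrier (Sym M)" "?S `` {q} \<in> carrier (Sym M)"
    by (auto simp: Sym_def quotient_by_class)
  then have "(?S `` {p}, ?S `` {q}) \<in> ?R"
    using \<open>p \<approx> q\<close> GR eq_equiv_class_iff[OF eG] unfolding geq_def proj_def by blast
  then obtain p' q' where "(p', q') \<in> R" "?S `` {p} = ?S `` {p'}" "?S `` {q} = ?S `` {q'}"
    by auto
  moreover from this have "p' \<in> Pol" "q' \<in> Pol" using eR by (auto simp: equiv_def)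
  ultimately have "(p, p') \<in> R" "(q', q) \<in> R"
    using SR pq eq_equiv_class_iff[OF eS] by blast+
  then show ?thesis using \<open>(p', q') \<in> R\<close> eR by (meson equivE transE)
qed

lemma ext_power_simps [simp]:
  "add (ext_power M n g d) = add (Grassmann M n g)"
  "smult (ext_power M n g d) = smult (Grassmann M n g)"
  "zero (ext_power M n g d) = zero (Grassmann M n g)"
  by (simp_all add: ext_power_def)

lemma ext_power_carrier: "carrier (ext_power M n g d) = proj ` homogeneous M d"
  unfolding ext_power_def sym_degree_def homogeneous_def proj_def by (auto simp: image_image)

lemma proj_homogeneous: "p \<in> homogeneous M d \<Longrightarrow> proj p \<in> carrier (ext_power M n g d)"
  by (simp add: ext_power_carrier)

lemma semimodule_ext_power: "semimodule (ext_power M n g d)"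
proof -
  have "semimodule ((Grassmann M n g)\<lparr>carrier := proj ` homogeneous M d\<rparr>)"
  proof (rule semimodule_restrict[OF semimodule_Grassmann])
    show "proj ` homogeneous M d \<subseteq> carrier (Grassmann M n g)"
      by (auto intro!: proj_closed homogeneous_carrier)
    show "\<zero>\<^bsub>Grassmann M n g\<^esub> \<in> proj ` homogeneous M d" by (simp flip: proj_zero)
  qed (auto simp: homogeneous_carrier simp flip: proj_add proj_smult)
  moreover have "(Grassmann M n g)\<lparr>carrier := proj ` homogeneous M d\<rparr> = ext_power M n g d"
    unfolding ext_power_carrier[symmetric] by (simp add: ext_power_def)
  ultimately show ?thesis by simp
qed

lemma proj_sum:
  "(\<And>i. i \<in> I \<Longrightarrow> f i \<in> homogeneous M d) \<Longrightarrow>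
    proj (sum f I) = (\<Oplus>\<^bsub>ext_power M n g d\<^esub>i\<in>I. proj (f i))"
proof (induction I rule: infinite_finite_induct)
  case (insert i I)
  interpret E: semimodule "ext_power M n g d" by (rule semimodule_ext_power)
  have "f i \<in> homogeneous M d" "sum f I \<in> homogeneous M d" using insert by auto
  then have "proj (f i + sum f I) = proj (f i) \<oplus>\<^bsub>Grassmann M n g\<^esub> proj (sum f I)"
    by (intro proj_add homogeneous_carrier)
  moreover have "(\<lambda>i. proj (f i)) \<in> I \<rightarrow> carrier (ext_power M n g d)"
    "proj (f i) \<in> carrier (ext_power M n g d)"
    using insert by (auto intro!: proj_homogeneous)
  ultimately show ?case using insert by simp
next
  case (infinite I)
  interpret E: semimodule "ext_power M n g d" by (rule semimodule_ext_power)
  from infinite show ?case by (simp add: proj_zero E.finsum_infinite)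
next
  case empty
  interpret E: semimodule "ext_power M n g d" by (rule semimodule_ext_power)
  show ?case by (simp add: proj_zero)
qed

definition gmono :: "nat set \<Rightarrow> ('m multiset \<Rightarrow>\<^sub>0 's)" where
  "gmono I = (\<Prod>i\<in>I. poly_var (g i))"

lemma gmono_homogeneous: "I \<subseteq> {1..n} \<Longrightarrow> card I = d \<Longrightarrow> gmono I \<in> homogeneous M d"
  using homogeneous_prod_var[of I g M] gen_closed unfolding gmono_def by blast

lemma gmono_Pol: "I \<subseteq> {1..n} \<Longrightarrow> gmono I \<in> Pol"
  using gmono_homogeneous homogeneous_carrier by blast

lemma wedge_monomial_eq: "I \<subseteq> {1..n} \<Longrightarrow> wedge_monomial M n g I = proj (gmono I)"
proof -
  assume I: "I \<subseteq> {1..n}"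
  interpret Gm: comm_monoid "Grassmann M n g" by (rule comm_monoid_Grassmann)
  have "finite I" using I by (rule finite_subset) simp
  then show ?thesis using I
  proof (induction I)
    case empty
    then show ?case by (simp add: wedge_monomial_def gmono_def proj_one)
  next
    case (insert i I)
    have "(\<lambda>i. proj (poly_var (g i))) \<in> I \<rightarrow> carrier (Grassmann M n g)"
      "proj (poly_var (g i)) \<in> carrier (Grassmann M n g)"
      using insert by (auto intro!: proj_closed poly_algebra_var gen_closed)
    moreover have "proj (poly_var (g i) * gmono I)
        = proj (poly_var (g i)) \<otimes>\<^bsub>Grassmann M n g\<^esub> proj (gmono I)"
      unfolding gmono_def using insert
      by (intro proj_mult poly_algebra_prod poly_algebra_var gen_closed) auto
    ultimately show ?case using insert
      by (simp add: wedge_monomial_def gmono_def grassmann_of_eq)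
  qed
qed

text \<open>
  The multiplication table because of which the squarefree monomials span the Grassmann algebra, and
  because of which multiplying a relation in degree one by a squarefree monomial drops terms.
\<close>

lemma var_mono:
  assumes "I \<subseteq> {1..n}" "i \<in> {1..n}"
  shows "poly_var (g i) * gmono I \<approx> (if i \<in> I then 0 else gmono (insert i I))"
proof (cases "i \<in> I")
  case True
  have fin: "finite I" using assms(1) by (rule finite_subset) simp
  have "poly_var (g i) * gmono I = (poly_var (g i) * poly_var (g i)) * gmono (I - {i})"
    unfolding gmono_def using True fin by (simp add: prod.remove mult.assoc)
  also have "\<dots> \<approx> 0 * gmono (I - {i})"
    using assms by (intro geq_mult geq_gen_square geq_refl gmono_Pol) auto
  finally show ?thesis using True by simp
next
  case False
  have fin: "finite I" using assms(1) by (rule finite_subset) simp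
  have "poly_var (g i) * gmono I \<in> Pol"
    using assms by (intro poly_algebra_mult poly_algebra_var gen_closed gmono_Pol) auto
  with fin show ?thesis using False by (simp add: gmono_def)
qed

end

section \<open>Substitution and functionals on squarefree monomials\<close>

text \<open>
  The algebra homomorphism that sends each variable \<open>x\<close> to \<open>l x\<close>.
\<close>

definition poly_subst ::
  "('m \<Rightarrow> ('k::comm_monoid_add \<Rightarrow>\<^sub>0 's)) \<Rightarrow> ('m multiset \<Rightarrow>\<^sub>0 's::comm_semiring_1) \<Rightarrow> ('k \<Rightarrow>\<^sub>0 's)" where
  "poly_subst l p = (\<Sum>k\<in>Poly_Mapping.keys p.
     Poly_Mapping.single 0 (Poly_Mapping.lookup p k) * prod_mset (image_mset l k))"

lemma poly_subst_superset:
  assumes "finite K" "Poly_Mapping.keys p \<subseteq> K"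
  shows "poly_subst l p = (\<Sum>k\<in>K.
    Poly_Mapping.single 0 (Poly_Mapping.lookup p k) * prod_mset (image_mset l k))"
  unfolding poly_subst_def
  by (rule sum.mono_neutral_left) (use assms in \<open>auto simp: in_keys_iff\<close>)

lemma poly_subst_zero [simp]: "poly_subst l 0 = 0"
  by (simp add: poly_subst_def)

lemma poly_subst_add: "poly_subst l (p + q) = poly_subst l p + poly_subst l q"
proof -
  let ?K = "Poly_Mapping.keys p \<union> Poly_Mapping.keys q"
  have "finite ?K" "Poly_Mapping.keys (p + q) \<subseteq> ?K"
    using keys_add[of p q] by auto
  then show ?thesis
    by (simp add: poly_subst_superset[of ?K] lookup_add single_add distrib_right sum.distrib)
qed

lemma poly_subst_sum: "poly_subst l (sum f I) = (\<Sum>i\<in>I. poly_subst l (f i))"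
  by (induction I rule: infinite_finite_induct) (auto simp: poly_subst_add)

lemma poly_subst_single:
  "poly_subst l (Poly_Mapping.single k a) = Poly_Mapping.single 0 a * prod_mset (image_mset l k)"
  by (subst poly_subst_superset[of "{k}"]) (auto split: if_splits)

lemma poly_mapping_expand:
  "p = (\<Sum>k\<in>Poly_Mapping.keys p. Poly_Mapping.single k (Poly_Mapping.lookup p k))"
proof (rule poly_mapping_eqI)
  fix k
  have "(\<Sum>j\<in>Poly_Mapping.keys p. Poly_Mapping.lookup (Poly_Mapping.single j (Poly_Mapping.lookup p j)) k)
      = (\<Sum>j\<in>Poly_Mapping.keys p. if j = k then Poly_Mapping.lookup p k else 0)"
    by (rule sum.cong) (auto simp: lookup_single when_def)
  then show "Poly_Mapping.lookup p k = Poly_Mapping.lookup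
      (\<Sum>k\<in>Poly_Mapping.keys p. Poly_Mapping.single k (Poly_Mapping.lookup p k)) k"
    by (simp add: lookup_sum in_keys_iff)
qed

lemma poly_subst_mult:
  fixes l :: "'m \<Rightarrow> ('k::comm_monoid_add \<Rightarrow>\<^sub>0 's::comm_semiring_1)"
  shows "poly_subst l (p * q) = poly_subst l p * poly_subst l q"
proof -
  let ?t = "\<lambda>p k. Poly_Mapping.single k (Poly_Mapping.lookup p k)"
  have single: "poly_subst l (Poly_Mapping.single k a * Poly_Mapping.single k' b) =
      poly_subst l (Poly_Mapping.single k a) * poly_subst l (Poly_Mapping.single k' b)" for k a k' b
  proof -
    let ?P = "\<lambda>k. prod_mset (image_mset l k)"
    have const: "Poly_Mapping.single (0::'k) (a * b)
        = Poly_Mapping.single 0 a * Poly_Mapping.single 0 b"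
      by (simp add: mult_single)
    have "poly_subst l (Poly_Mapping.single k a * Poly_Mapping.single k' b)
        = Poly_Mapping.single 0 (a * b) * (?P k * ?P k')"
      by (simp add: mult_single poly_subst_single)
    also have "\<dots> = (Poly_Mapping.single 0 a * ?P k) * (Poly_Mapping.single 0 b * ?P k')"
      unfolding const by (simp only: mult_ac)
    finally show ?thesis by (simp add: poly_subst_single)
  qed
  have "poly_subst l (p * q)
      = poly_subst l ((\<Sum>k\<in>Poly_Mapping.keys p. ?t p k) * (\<Sum>k\<in>Poly_Mapping.keys q. ?t q k))"
    by (simp flip: poly_mapping_expand)
  also have "\<dots> = (\<Sum>k\<in>Poly_Mapping.keys p. poly_subst l (?t p k)) *
      (\<Sum>k\<in>Poly_Mapping.keys q. poly_subst l (?t q k))"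
    by (simp add: sum_product poly_subst_sum single)
  also have "\<dots> = poly_subst l p * poly_subst l q"
    by (simp flip: poly_subst_sum poly_mapping_expand)
  finally show ?thesis .
qed

lemma poly_subst_const [simp]: "poly_subst l (Poly_Mapping.single 0 a) = Poly_Mapping.single 0 a"
  by (simp add: poly_subst_single)

lemma poly_subst_one [simp]: "poly_subst l 1 = 1"
  using poly_subst_const[of l 1] by simp

lemma poly_subst_var [simp]: "poly_subst l (poly_var x) = l x"
  by (simp add: poly_var_def poly_subst_single)

lemma poly_subst_prod: "poly_subst l (prod f I) = (\<Prod>i\<in>I. poly_subst l (f i))"
  by (induction I rule: infinite_finite_induct) (auto simp: poly_subst_mult)

text \<open>
  The linear functional on the polynomials in variables indexed by numbers that is \<open>c I\<close> on the
  product of the variables in \<open>I \<subseteq> {1..n}\<close> and vanishes on all other monomials. Vanishing on the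
  multiples of squares is what makes it a functional on a Grassmann algebra.
\<close>

definition sqf_functional ::
  "nat \<Rightarrow> (nat set \<Rightarrow> 's) \<Rightarrow> (nat multiset \<Rightarrow>\<^sub>0 's::comm_semiring_1) \<Rightarrow> 's" where
  "sqf_functional n c p = (\<Sum>I\<in>Pow {1..n}. c I * Poly_Mapping.lookup p (mset_set I))"

lemma sqf_functional_zero [simp]: "sqf_functional n c 0 = 0"
  by (simp add: sqf_functional_def)

lemma sqf_functional_add: "sqf_functional n c (p + q) = sqf_functional n c p + sqf_functional n c q"
  by (simp add: sqf_functional_def lookup_add distrib_left sum.distrib)

lemma sqf_functional_sum: "sqf_functional n c (sum f I) = (\<Sum>i\<in>I. sqf_functional n c (f i))"
  by (induction I rule: infinite_finite_induct) (auto simp: sqf_functional_add)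

lemma lookup_const_mult:
  "Poly_Mapping.lookup (Poly_Mapping.single 0 a * p) k = a * Poly_Mapping.lookup p k"
  by (auto simp: Poly_Mapping.map.rep_eq when_def simp flip: mult_map_scale_conv_mult)

lemma sqf_functional_smult:
  "sqf_functional n c (Poly_Mapping.single 0 a * p) = a * sqf_functional n c p"
  by (simp add: sqf_functional_def lookup_const_mult sum_distrib_left mult.left_commute)

lemma sqf_functional_mset_set:
  assumes "I \<subseteq> {1..n}"
  shows "sqf_functional n c (Poly_Mapping.single (mset_set I) a) = a * c I"
proof -
  have "mset_set I = mset_set J \<longleftrightarrow> J = I" if "J \<in> Pow {1..n}" for J
    using that assms by (metis PowD finite_atLeastAtMost finite_set_mset_mset_set finite_subset)
  then have "sqf_functional n c (Poly_Mapping.single (mset_set I) a)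
      = (\<Sum>J\<in>Pow {1..n}. if J = I then a * c I else 0)"
    unfolding sqf_functional_def by (intro sum.cong) (auto simp: lookup_single when_def mult.commute)
  then show ?thesis using assms by simp
qed

lemma sqf_functional_not_mset_set:
  assumes "\<And>I. I \<subseteq> {1..n} \<Longrightarrow> k \<noteq> mset_set I"
  shows "sqf_functional n c (Poly_Mapping.single k a) = 0"
  unfolding sqf_functional_def using assms by (auto simp: lookup_single when_def intro!: sum.neutral)

lemma sqf_functional_add_mset:
  assumes "B \<subseteq> {1..n}" "i \<in> {1..n}"
  shows "sqf_functional n c (Poly_Mapping.single (add_mset i (mset_set B)) a)
    = (if i \<in> B then 0 else a * c (insert i B))"
proof (cases "i \<in> B")
  case True
  have "finite B" using assms(1) by (rule finite_subset) simp
  then have "count (add_mset i (mset_set B)) i = 2" using True by simp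
  moreover have "count (mset_set I) i \<le> 1" for I by (cases "finite I"; cases "i \<in> I") auto
  ultimately have "add_mset i (mset_set B) \<noteq> mset_set I" for I by (metis one_le_numeral numeral_le_one_iff semiring_norm(69))
  then show ?thesis using True by (simp add: sqf_functional_not_mset_set)
next
  case False
  have "finite B" using assms(1) by (rule finite_subset) simp
  then have "add_mset i (mset_set B) = mset_set (insert i B)" using False by simp
  then show ?thesis using False assms sqf_functional_mset_set[of "insert i B" n c a] by simp
qed

definition linear_form :: "nat \<Rightarrow> (nat \<Rightarrow> 's) \<Rightarrow> (nat multiset \<Rightarrow>\<^sub>0 's::comm_semiring_1)" where
  "linear_form n f = (\<Sum>i\<in>{1..n}. Poly_Mapping.single {#i#} (f i))"

text \<open>
  If \<open>c\<close> is regarded as an alternating form, this is its contraction with \<open>f\<close>, evaluated at \<open>B\<close>.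
\<close>

definition pairing ::
  "nat \<Rightarrow> (nat set \<Rightarrow> 's) \<Rightarrow> (nat \<Rightarrow> 's) \<Rightarrow> nat set \<Rightarrow> 's::comm_semiring_1" where
  "pairing n c f B = (\<Sum>i\<in>{1..n} - B. f i * c (insert i B))"

lemma sqf_functional_linear_form:
  assumes "B \<subseteq> {1..n}"
  shows "sqf_functional n c (Poly_Mapping.single (mset_set B) 1 * linear_form n f) = pairing n c f B"
proof -
  have "sqf_functional n c (Poly_Mapping.single (mset_set B) 1 * linear_form n f)
      = (\<Sum>i\<in>{1..n}. if i \<in> B then 0 else f i * c (insert i B))"
    unfolding linear_form_def
    by (simp add: sum_distrib_left mult_single sqf_functional_sum)
      (rule sum.cong, auto simp: sqf_functional_add_mset[OF assms])
  also have "\<dots> = pairing n c f B"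
    unfolding pairing_def by (rule sum.mono_neutral_cong_right) auto
  finally show ?thesis .
qed

text \<open>
  A variable times a monomial is squarefree only if the monomial is, so the remaining monomials
  contribute nothing and linear forms are tested by the monomials of subsets.
\<close>

lemma sqf_functional_linear_form_other:
  assumes "\<And>I. I \<subseteq> {1..n} \<Longrightarrow> k \<noteq> mset_set I"
  shows "sqf_functional n c (Poly_Mapping.single k 1 * linear_form n f) = 0"
proof -
  have "add_mset i k \<noteq> mset_set I" if "I \<subseteq> {1..n}" for i I
  proof
    assume eq: "add_mset i k = mset_set I"
    have "finite I" using that by (rule finite_subset) simp
    moreover from this have "i \<in> I" using eq by (metis elem_mset_set union_single_eq_member)
    ultimately have "k = mset_set (I - {i})" using eq mset_set.remove[of I i] by simp
    then show False using assms that by blast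
  qed
  then have "sqf_functional n c (Poly_Mapping.single (add_mset i k) (f i)) = 0" for i
    by (intro sqf_functional_not_mset_set) auto
  then show ?thesis
    unfolding linear_form_def
    by (simp add: sum_distrib_left mult_single sqf_functional_sum)
qed

text \<open>
  The largest algebra congruence on whose classes the functional is constant. It identifies the
  square of each variable with \<open>0\<close>, and on linear forms it is decided by the pairing.
\<close>

definition sqf_equiv ::
  "nat \<Rightarrow> (nat set \<Rightarrow> 's) \<Rightarrow> (nat multiset \<Rightarrow>\<^sub>0 's::comm_semiring_1) \<Rightarrow> (nat multiset \<Rightarrow>\<^sub>0 's) \<Rightarrow> bool"
  where "sqf_equiv n c p q \<longleftrightarrow> (\<forall>r. sqf_functional n c (r * p) = sqf_functional n c (r * q))"

lemma sqf_equivD: "sqf_equiv n c p q \<Longrightarrow> sqf_functional n c p = sqf_functional n c q"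
  unfolding sqf_equiv_def by (metis mult_1)

lemma sqf_equiv_refl [simp]: "sqf_equiv n c p p"
  by (simp add: sqf_equiv_def)

lemma sqf_equiv_add:
  "sqf_equiv n c p p' \<Longrightarrow> sqf_equiv n c q q' \<Longrightarrow> sqf_equiv n c (p + q) (p' + q')"
  by (simp add: sqf_equiv_def distrib_left sqf_functional_add)

lemma sqf_equiv_mult:
  assumes "sqf_equiv n c p p'" "sqf_equiv n c q q'"
  shows "sqf_equiv n c (p * q) (p' * q')"
proof -
  have "sqf_functional n c (r * (p * q)) = sqf_functional n c (r * (p' * q'))" for r
  proof -
    have "sqf_functional n c ((r * q) * p) = sqf_functional n c ((r * q) * p')"
      using assms(1) unfolding sqf_equiv_def by blast
    moreover have "sqf_functional n c ((r * p') * q) = sqf_functional n c ((r * p') * q')"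
      using assms(2) unfolding sqf_equiv_def by blast
    ultimately show ?thesis by (simp add: mult_ac)
  qed
  then show ?thesis by (simp add: sqf_equiv_def)
qed

lemma sqf_equiv_prod:
  "(\<And>i. i \<in> I \<Longrightarrow> sqf_equiv n c (p i) (q i)) \<Longrightarrow> sqf_equiv n c (prod p I) (prod q I)"
  by (induction I rule: infinite_finite_induct) (auto intro: sqf_equiv_mult)

lemma sqf_equivI:
  assumes "\<And>k. sqf_functional n c (Poly_Mapping.single k 1 * p)
    = sqf_functional n c (Poly_Mapping.single k 1 * q)"
  shows "sqf_equiv n c p q"
  unfolding sqf_equiv_def
proof
  fix r
  have mon: "sqf_functional n c (Poly_Mapping.single k a * p)
      = sqf_functional n c (Poly_Mapping.single k a * q)" for k a
  proof -
    have "Poly_Mapping.single k a = Poly_Mapping.single 0 a * Poly_Mapping.single k 1"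
      by (simp add: mult_single)
    then show ?thesis using assms[of k] by (simp add: mult.assoc sqf_functional_smult)
  qed
  have "sqf_functional n c (r * u) = (\<Sum>k\<in>Poly_Mapping.keys r. sqf_functional n c
      (Poly_Mapping.single k (Poly_Mapping.lookup r k) * u))" for u
    by (subst poly_mapping_expand[of r]) (simp add: sum_distrib_right sqf_functional_sum)
  then show "sqf_functional n c (r * p) = sqf_functional n c (r * q)" by (simp add: mon)
qed

lemma sqf_equiv_linear_form:
  assumes "\<And>B. B \<subseteq> {1..n} \<Longrightarrow> pairing n c f B = pairing n c f' B"
  shows "sqf_equiv n c (linear_form n f) (linear_form n f')"
proof (rule sqf_equivI)
  fix k
  show "sqf_functional n c (Poly_Mapping.single k 1 * linear_form n f)
    = sqf_functional n c (Poly_Mapping.single k 1 * linear_form n f')"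
  proof (cases "\<exists>B. B \<subseteq> {1..n} \<and> k = mset_set B")
    case True
    then show ?thesis using assms by (auto simp: sqf_functional_linear_form)
  next
    case False
    then have k: "\<And>I. I \<subseteq> {1..n} \<Longrightarrow> k \<noteq> mset_set I" by blast
    show ?thesis
      using sqf_functional_linear_form_other[of n k c f, OF k]
        sqf_functional_linear_form_other[of n k c f', OF k] by metis
  qed
qed

lemma sqf_equiv_square:
  "sqf_equiv n c (Poly_Mapping.single {#i#} 1 * Poly_Mapping.single {#i#} 1) 0"
proof (rule sqf_equivI)
  fix k
  have "count (add_mset i (add_mset i k)) i \<ge> 2" by simp
  moreover have "count (mset_set I) i \<le> 1" for I by (cases "finite I"; cases "i \<in> I") auto
  ultimately have "add_mset i (add_mset i k) \<noteq> mset_set I" for I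
    by (metis dual_order.trans numeral_le_one_iff semiring_norm(69))
  then have "sqf_functional n c (Poly_Mapping.single (add_mset i (add_mset i k)) 1) = 0"
    by (intro sqf_functional_not_mset_set) auto
  then show "sqf_functional n c (Poly_Mapping.single k 1 *
      (Poly_Mapping.single {#i#} 1 * Poly_Mapping.single {#i#} 1))
    = sqf_functional n c (Poly_Mapping.single k 1 * 0)"
    by (simp add: mult_single)
qed

lemma linear_form_var:
  "i \<in> {1..n} \<Longrightarrow> linear_form n (\<lambda>j. if j = i then 1 else 0) = Poly_Mapping.single {#i#} 1"
  unfolding linear_form_def by (subst sum.remove[of _ i]) auto

lemma pairing_var:
  "i \<in> {1..n} \<Longrightarrow>
    pairing n c (\<lambda>j. if j = i then 1 else 0) B = (if i \<in> B then 0 else c (insert i B))"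
  unfolding pairing_def
  by (cases "i \<in> B") (auto simp: if_distrib[of "\<lambda>x. x * _"] cong: if_cong intro!: sum.neutral)

lemma pairing_cong: "(\<And>i. i \<in> {1..n} \<Longrightarrow> f i = f' i) \<Longrightarrow> pairing n c f B = pairing n c f' B"
  unfolding pairing_def by (rule sum.cong) auto

lemma pairing_add: "pairing n c (\<lambda>i. f i + f' i) B = pairing n c f B + pairing n c f' B"
  by (simp add: pairing_def distrib_right sum.distrib)

lemma pairing_smult: "pairing n c (\<lambda>i. a * f i) B = a * pairing n c f B"
  by (simp add: pairing_def sum_distrib_left mult.assoc)

lemma linear_form_add: "linear_form n (\<lambda>i. f i + f' i) = linear_form n f + linear_form n f'"
  by (simp add: linear_form_def single_add sum.distrib)

lemma linear_form_smult:
  "linear_form n (\<lambda>i. a * f i) = Poly_Mapping.single 0 a * linear_form n f"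
  by (simp add: linear_form_def sum_distrib_left mult_single)

text \<open>
  Data for a functional on the Grassmann algebra of \<open>M\<close> with values \<open>c\<close> on the squarefree monomials.
  The vector \<open>\<rho> x\<close> is thought of as the coefficients of \<open>x\<close> in the generators. It is asked to depend
  linearly on \<open>x\<close> only after pairing with \<open>c\<close>, so that for a quotient module it may be computed from
  arbitrarily chosen representatives.
\<close>

locale alternating_functional = generated_semimodule M n g
  for M :: "('s::comm_semiring_1, 'm, 'r) module_scheme" (structure) and n g +
  fixes \<rho> :: "'m \<Rightarrow> nat \<Rightarrow> 's" and c :: "nat set \<Rightarrow> 's"
  assumes pairing_rep_add: "\<lbrakk>x \<in> carrier M; y \<in> carrier M; B \<subseteq> {1..n}\<rbrakk> \<Longrightarrow>
      pairing n c (\<rho> (x \<oplus> y)) B = pairing n c (\<rho> x) B + pairing n c (\<rho> y) B"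
    and pairing_rep_smult: "\<lbrakk>x \<in> carrier M; B \<subseteq> {1..n}\<rbrakk> \<Longrightarrow>
      pairing n c (\<rho> (a \<odot> x)) B = a * pairing n c (\<rho> x) B"
    and pairing_rep_gen: "\<lbrakk>i \<in> {1..n}; B \<subseteq> {1..n}\<rbrakk> \<Longrightarrow>
      pairing n c (\<rho> (g i)) B = (if i \<in> B then 0 else c (insert i B))"
begin

abbreviation rep_subst :: "('m multiset \<Rightarrow>\<^sub>0 's) \<Rightarrow> (nat multiset \<Rightarrow>\<^sub>0 's)" where
  "rep_subst \<equiv> poly_subst (\<lambda>x. linear_form n (\<rho> x))"

definition functional :: "('m multiset \<Rightarrow>\<^sub>0 's) \<Rightarrow> 's" where
  "functional p = sqf_functional n c (rep_subst p)"

lemma sqf_equiv_gen: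
  "i \<in> {1..n} \<Longrightarrow> sqf_equiv n c (linear_form n (\<rho> (g i))) (Poly_Mapping.single {#i#} 1)"
  by (subst linear_form_var[of i n, symmetric])
    (auto intro: sqf_equiv_linear_form simp: pairing_rep_gen pairing_var)

text \<open>
  Substituting the representing linear forms for the variables pulls the congruence of the functional
  back to an algebra congruence on the polynomial algebra of \<open>M\<close>. It contains the relations that
  generate the kernel, hence contains the kernel.
\<close>

lemma functional_cong:
  assumes "p \<approx> q"
  shows "functional p = functional q"
proof -
  let ?R = "{(p, q). p \<in> Pol \<and> q \<in> Pol \<and> sqf_equiv n c (rep_subst p) (rep_subst q)}"
  have "equiv Pol ?R"
    by (rule equivI) (auto simp: sqf_equiv_def intro!: refl_onI symI transI)
  then have "algebra_congruence (poly_algebra M) ?R"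
    by (intro algebra_congruenceI module_congruenceI)
      (auto simp: poly_subst_add poly_subst_mult intro!: sqf_equiv_add sqf_equiv_mult)
  then have "(p, q) \<in> ?R"
  proof (rule geq_least)
    show "(poly_var (x \<oplus> y), poly_var x + poly_var y) \<in> ?R"
      if "x \<in> carrier M" "y \<in> carrier M" for x y
      using that pairing_rep_add
      by (auto simp: poly_subst_add pairing_add simp flip: linear_form_add
          intro!: sqf_equiv_linear_form)
    show "(poly_var (a \<odot> x), Poly_Mapping.single 0 a * poly_var x) \<in> ?R"
      if "x \<in> carrier M" for a x
      using that pairing_rep_smult
      by (auto simp: poly_subst_mult pairing_smult simp flip: linear_form_smult
          intro!: sqf_equiv_linear_form)
    show "(poly_var (g i) * poly_var (g i), 0) \<in> ?R" if i: "i \<in> {1..n}" for i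
    proof -
      have "sqf_equiv n c (linear_form n (\<rho> (g i)) * linear_form n (\<rho> (g i)))
          (Poly_Mapping.single {#i#} 1 * Poly_Mapping.single {#i#} 1)"
        using i by (intro sqf_equiv_mult sqf_equiv_gen)
      then have "sqf_equiv n c (linear_form n (\<rho> (g i)) * linear_form n (\<rho> (g i))) 0"
        using sqf_equiv_square unfolding sqf_equiv_def by metis
      then show ?thesis using gen_closed[OF i] by (auto simp: poly_subst_mult)
    qed
  qed (rule assms)
  then show ?thesis unfolding functional_def by (auto intro: sqf_equivD)
qed

lemma functional_add: "functional (p + q) = functional p + functional q"
  by (simp add: functional_def poly_subst_add sqf_functional_add)

lemma functional_zero [simp]: "functional 0 = 0"
  by (simp add: functional_def)

lemma functional_smult: "functional (Poly_Mapping.single 0 a * p) = a * functional p"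
  by (simp add: functional_def poly_subst_mult sqf_functional_smult)

lemma functional_sum: "functional (sum f I) = (\<Sum>i\<in>I. functional (f i))"
  by (induction I rule: infinite_finite_induct) (auto simp: functional_add)

lemma functional_gmono:
  assumes "I \<subseteq> {1..n}"
  shows "functional (gmono I) = c I"
proof -
  have "finite I" using assms by (rule finite_subset) simp
  then have "(\<Prod>i\<in>I. Poly_Mapping.single {#i#} 1) = Poly_Mapping.single (mset_set I) (1::'s)"
    by (induction I) (auto simp: mult_single)
  moreover have "sqf_equiv n c (\<Prod>i\<in>I. linear_form n (\<rho> (g i))) (\<Prod>i\<in>I. Poly_Mapping.single {#i#} 1)"
    using assms by (intro sqf_equiv_prod sqf_equiv_gen) auto
  ultimately show ?thesis
    using sqf_functional_mset_set[OF assms, of c 1] sqf_equivD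
    by (fastforce simp: functional_def gmono_def poly_subst_prod)
qed

end

section \<open>Spanning by squarefree monomials\<close>

abbreviation subsets_of_card :: "nat \<Rightarrow> nat \<Rightarrow> nat set set" where
  "subsets_of_card n d \<equiv> {I. I \<subseteq> {1..n} \<and> card I = d}"

lemma finite_subsets_of_card: "finite (subsets_of_card n d)"
  by (rule finite_subset[of _ "Pow {1..n}"]) auto

context generated_semimodule
begin

lemma geq_var_finsum:
  assumes "finite I" "\<And>i. i \<in> I \<Longrightarrow> x i \<in> carrier M"
  shows "poly_var (\<Oplus>i\<in>I. a i \<odot> x i) \<approx> (\<Sum>i\<in>I. Poly_Mapping.single 0 (a i) * poly_var (x i))"
  using assms
proof (induction I)
  case empty
  then show ?case using geq_var_zero by simp
next
  case (insert i I)
  have cl: "(\<lambda>i. a i \<odot> x i) \<in> I \<rightarrow> carrier M" "a i \<odot> x i \<in> carrier M" "x i \<in> carrier M"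
    using insert by auto
  have "poly_var (\<Oplus>i\<in>insert i I. a i \<odot> x i)
      = poly_var (a i \<odot> x i \<oplus> (\<Oplus>i\<in>I. a i \<odot> x i))"
    using insert cl by simp
  also have "\<dots> \<approx> poly_var (a i \<odot> x i) + poly_var (\<Oplus>i\<in>I. a i \<odot> x i)"
    using cl by (intro geq_var_add finsum_closed)
  also have "\<dots> \<approx> Poly_Mapping.single 0 (a i) * poly_var (x i)
      + (\<Sum>i\<in>I. Poly_Mapping.single 0 (a i) * poly_var (x i))"
    using cl insert by (intro geq_add geq_var_smult) auto
  finally show ?case using insert by simp
qed

definition in_span :: "nat \<Rightarrow> ('m multiset \<Rightarrow>\<^sub>0 's) \<Rightarrow> bool" where
  "in_span d p \<longleftrightarrow> (\<exists>c. p \<approx> (\<Sum>I\<in>subsets_of_card n d. Poly_Mapping.single 0 (c I) * gmono I))"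

lemma in_spanI:
  "p \<approx> (\<Sum>I\<in>subsets_of_card n d. Poly_Mapping.single 0 (c I) * gmono I) \<Longrightarrow> in_span d p"
  unfolding in_span_def by (rule exI)

lemma in_span_cong: "p \<approx> q \<Longrightarrow> in_span d q \<Longrightarrow> in_span d p"
  unfolding in_span_def using geq_trans by blast

lemma in_span_add:
  assumes "in_span d p" "in_span d q"
  shows "in_span d (p + q)"
proof -
  obtain c c' where "p \<approx> (\<Sum>I\<in>subsets_of_card n d. Poly_Mapping.single 0 (c I) * gmono I)"
    "q \<approx> (\<Sum>I\<in>subsets_of_card n d. Poly_Mapping.single 0 (c' I) * gmono I)"
    using assms unfolding in_span_def by blast
  from geq_add[OF this]
  have "p + q \<approx> (\<Sum>I\<in>subsets_of_card n d. Poly_Mapping.single 0 (c I + c' I) * gmono I)"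
    by (simp add: single_add distrib_right sum.distrib)
  then show ?thesis by (rule in_spanI)
qed

lemma in_span_smult:
  assumes "in_span d p"
  shows "in_span d (Poly_Mapping.single 0 a * p)"
proof -
  obtain c where "p \<approx> (\<Sum>I\<in>subsets_of_card n d. Poly_Mapping.single 0 (c I) * gmono I)"
    using assms unfolding in_span_def by blast
  from geq_mult[OF geq_refl[OF poly_algebra_const] this, of a]
  have "Poly_Mapping.single 0 a * p
      \<approx> (\<Sum>I\<in>subsets_of_card n d. Poly_Mapping.single 0 (a * c I) * gmono I)"
    by (simp add: sum_distrib_left mult_single flip: mult.assoc)
  then show ?thesis by (rule in_spanI)
qed

lemma in_span_zero: "in_span d 0"
  unfolding in_span_def by (rule exI[of _ "\<lambda>_. 0"]) simp

lemma in_span_sum: "(\<And>i. i \<in> I \<Longrightarrow> in_span d (f i)) \<Longrightarrow> in_span d (sum f I)"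
  by (induction I rule: infinite_finite_induct) (auto intro: in_span_zero in_span_add)

lemma in_span_gmono:
  assumes "I \<subseteq> {1..n}" "card I = d"
  shows "in_span d (gmono I)"
proof -
  have "(\<Sum>J\<in>subsets_of_card n d. Poly_Mapping.single 0 (if J = I then 1 else 0) * gmono J)
      = (\<Sum>J\<in>subsets_of_card n d. if J = I then gmono I else 0)"
    by (rule sum.cong) auto
  also have "\<dots> = gmono I" using assms finite_subsets_of_card by simp
  finally have "(\<Sum>J\<in>subsets_of_card n d. Poly_Mapping.single 0 (if J = I then 1 else 0) * gmono J)
      = gmono I" .
  then show ?thesis unfolding in_span_def using assms gmono_Pol
    by (intro exI[of _ "\<lambda>J. if J = I then 1 else 0"]) auto
qed

lemma in_span_var_mult:
  assumes "i \<in> {1..n}" "in_span d p"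
  shows "in_span (Suc d) (poly_var (g i) * p)"
proof -
  obtain c where "p \<approx> (\<Sum>I\<in>subsets_of_card n d. Poly_Mapping.single 0 (c I) * gmono I)"
    using assms unfolding in_span_def by blast
  from geq_mult[OF geq_refl[OF poly_algebra_var[OF gen_closed[OF assms(1)]]] this]
  have "poly_var (g i) * p
      \<approx> (\<Sum>I\<in>subsets_of_card n d. Poly_Mapping.single 0 (c I) * (poly_var (g i) * gmono I))"
    by (simp add: sum_distrib_left mult_ac)
  moreover have "in_span (Suc d) (poly_var (g i) * gmono I)" if I: "I \<in> subsets_of_card n d" for I
  proof -
    have "finite I" using I by (auto intro: finite_subset)
    then have "in_span (Suc d) (if i \<in> I then 0 else gmono (insert i I))"
      using I assms by (auto intro!: in_span_zero in_span_gmono)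
    then show ?thesis using in_span_cong var_mono I assms by blast
  qed
  ultimately show ?thesis
    by (elim in_span_cong) (intro in_span_sum in_span_smult, simp only:)
qed

text \<open>
  The variables of a monomial are expanded in the generators one at a time; each generator multiplies
  a squarefree monomial to a squarefree monomial or to \<open>0\<close>.
\<close>

lemma homogeneous_in_span:
  assumes span: "\<And>x. x \<in> carrier M \<Longrightarrow> \<exists>a. x = (\<Oplus>i\<in>{1..n}. a i \<odot> g i)"
    and p: "p \<in> homogeneous M d"
  shows "in_span d p"
proof -
  have var: "in_span (Suc d) (poly_var x * q)" if x: "x \<in> carrier M" and q: "in_span d q" for x d q
  proof -
    obtain a where "x = (\<Oplus>i\<in>{1..n}. a i \<odot> g i)" using span[OF x] by blast
    then have "poly_var x \<approx> (\<Sum>i\<in>{1..n}. Poly_Mapping.single 0 (a i) * poly_var (g i))"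
      by (simp only:) (rule geq_var_finsum, simp, erule gen_closed)
    moreover have "q \<approx> q" using q geq_Pol unfolding in_span_def by blast
    ultimately have "poly_var x * q
        \<approx> (\<Sum>i\<in>{1..n}. Poly_Mapping.single 0 (a i) * poly_var (g i)) * q"
      by (rule geq_mult)
    also have "\<dots> = (\<Sum>i\<in>{1..n}. Poly_Mapping.single 0 (a i) * (poly_var (g i) * q))"
      by (simp add: sum_distrib_right mult.assoc)
    finally show ?thesis
      by (rule in_span_cong) (intro in_span_sum in_span_smult in_span_var_mult q)
  qed
  have monomial: "in_span (size k) (Poly_Mapping.single k 1)" if "set_mset k \<subseteq> carrier M" for k
    using that
  proof (induction k)
    case empty
    have "gmono {} = 1" by (simp add: gmono_def)
    then show ?case using in_span_gmono[of "{}" 0] by simp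
  next
    case (add x k)
    have "Poly_Mapping.single (add_mset x k) (1::'s) = poly_var x * Poly_Mapping.single k 1"
      by (simp add: poly_var_def mult_single)
    then show ?case using add var by simp
  qed
  have "in_span d (Poly_Mapping.single k (Poly_Mapping.lookup p k))"
    if "k \<in> Poly_Mapping.keys p" for k
  proof -
    have "set_mset k \<subseteq> carrier M" "size k = d"
      using p that by (auto simp: homogeneous_def poly_algebra_carrier)
    then have "in_span d (Poly_Mapping.single 0 (Poly_Mapping.lookup p k) * Poly_Mapping.single k 1)"
      using monomial by (auto intro!: in_span_smult)
    then show ?thesis by (simp add: mult_single)
  qed
  then show ?thesis by (subst poly_mapping_expand) (rule in_span_sum)
qed

end

section \<open>Exchange of bases\<close>

lemma semifield_mult_eq_0_iff [simp]:
  fixes a b :: "'s::idempotent_semifield"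
  shows "a * b = 0 \<longleftrightarrow> a = 0 \<or> b = 0"
proof -
  have "b = 0" if ab: "a * b = 0" and a: "a \<noteq> 0"
  proof -
    obtain a' where "a * a' = 1" using ex_mult_inverse[OF a] by blast
    then have "b = a' * (a * b)" by (metis mult.assoc mult.commute mult_1)
    then show ?thesis using ab by simp
  qed
  then show ?thesis by auto
qed

lemma semifield_mult_left_cancel:
  fixes a b c :: "'s::idempotent_semifield"
  assumes "a \<noteq> 0" "a * b = a * c"
  shows "b = c"
proof -
  obtain a' where "a * a' = 1" using ex_mult_inverse[OF assms(1)] by blast
  then show ?thesis using assms(2) by (metis mult.assoc mult.commute mult_1)
qed

text \<open>
  For \<open>u = w\<close> these are the tropical Pluecker relations. With \<open>u\<close> kept apart from \<open>w\<close> they say that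
  \<open>u\<close> gives the values of a linear functional on the degree \<open>d\<close> part of the Grassmann algebra
  of \<open>Q\<^sub>w\<close>.
\<close>

definition exchange_relations ::
  "nat \<Rightarrow> nat \<Rightarrow> (nat set \<Rightarrow> 's) \<Rightarrow> (nat set \<Rightarrow> 's::comm_semiring_1) \<Rightarrow> bool" where
  "exchange_relations n d w u \<longleftrightarrow>
     (\<forall>A B. A \<subseteq> {1..n} \<and> card A = d + 1 \<and> B \<subseteq> {1..n} \<and> card B + 1 = d \<longrightarrow>
       (\<forall>p\<in>A - B. (\<Sum>i\<in>A - B. w (A - {i}) * u (B \<union> {i})) =
         (\<Sum>i\<in>A - B - {p}. w (A - {i}) * u (B \<union> {i}))))"

text \<open>
  The edges of the basis exchange graph on the support of \<open>w\<close>.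
\<close>

definition adjacent :: "nat \<Rightarrow> nat \<Rightarrow> (nat set \<Rightarrow> 's::zero) \<Rightarrow> (nat set \<times> nat set) set" where
  "adjacent n d w = {(I, J). I \<in> subsets_of_card n d \<and> J \<in> subsets_of_card n d \<and>
     w I \<noteq> 0 \<and> w J \<noteq> 0 \<and> (\<exists>i j. i \<in> I \<and> j \<notin> I \<and> J = insert j I - {i})}"

lemma swap_subsets_of_card:
  assumes "I \<in> subsets_of_card n d" "i \<in> I" "j \<notin> I" "j \<in> {1..n}"
  shows "insert j I - {i} \<in> subsets_of_card n d"
proof -
  have "finite I" using assms(1) by (auto intro: finite_subset)
  then have "card (insert j I - {i}) = card I"
    using assms by (simp add: card_Diff_singleton)
  then show ?thesis using assms by auto
qed

lemma card_remove_plus1: "finite J \<Longrightarrow> j \<in> J \<Longrightarrow> card J = d \<Longrightarrow> card (J - {j}) + 1 = d"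
  using card.remove[of J j] by linarith

lemma card_Diff_swap:
  assumes "finite J" "i \<notin> J" "j \<in> J" "j \<notin> I"
  shows "card (J - (insert j I - {i})) < card (J - I)"
proof -
  have "J - (insert j I - {i}) = J - I - {j}" using assms by auto
  also have "card (J - I - {j}) < card (J - I)" using assms by (intro card_Diff1_less) auto
  finally show ?thesis .
qed

text \<open>
  As in the exchange axiom for matroids: dropping the term \<open>w I * u J\<close> from a relation does not change
  its sum, which is then nonzero, so one of the other terms is nonzero. Its first factor is the value
  of \<open>w\<close> at a neighbour of \<open>I\<close> that is closer to \<open>J\<close>.
\<close>

lemma exchange_chain:
  fixes w u :: "nat set \<Rightarrow> 's::idempotent_semifield"
  assumes rel: "exchange_relations n d w u"
    and J: "J \<in> subsets_of_card n d" "u J \<noteq> 0"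
    and I: "I \<in> subsets_of_card n d" "w I \<noteq> 0"
  shows "(I, J) \<in> (adjacent n d w)\<^sup>*"
  using I
proof (induction "card (J - I)" arbitrary: I rule: less_induct)
  case less
  have fin: "finite I" "finite J" using less.prems J by (auto intro: finite_subset)
  show ?case
  proof (cases "J \<subseteq> I")
    case True
    then have "J = I" using fin less.prems J by (metis (mono_tags, lifting) card_subset_eq mem_Collect_eq)
    then show ?thesis by simp
  next
    case False
    then obtain j where j: "j \<in> J" "j \<notin> I" by blast
    let ?A = "insert j I" and ?B = "J - {j}"
    have "card ?A = d + 1" using less.prems j fin by simp
    then have card: "card ?A = d + 1" "card ?B + 1 = d"
      using less.prems J j fin card_remove_plus1[OF fin(2) j(1)] by blast+
    have sub: "?A \<subseteq> {1..n}" "?B \<subseteq> {1..n}" "j \<in> ?A - ?B" using less.prems J j by auto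
    have "(\<Sum>i\<in>?A - ?B. w (?A - {i}) * u (?B \<union> {i})) = (\<Sum>i\<in>?A - ?B - {j}. w (?A - {i}) * u (?B \<union> {i}))"
      using rel card sub unfolding exchange_relations_def by blast
    moreover have "(\<Sum>i\<in>?A - ?B. w (?A - {i}) * u (?B \<union> {i})) = w (?A - {j}) * u (?B \<union> {j})
        + (\<Sum>i\<in>?A - ?B - {j}. w (?A - {i}) * u (?B \<union> {i}))"
      using fin sub by (intro sum.remove) auto
    moreover have "?A - {j} = I" "?B \<union> {j} = J" using j by auto
    ultimately have "(\<Sum>i\<in>?A - ?B - {j}. w (?A - {i}) * u (?B \<union> {i})) \<noteq> 0"
      using less.prems J by auto
    then obtain i where i: "i \<in> ?A - ?B - {j}" "w (?A - {i}) * u (?B \<union> {i}) \<noteq> 0"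
      by (meson sum.not_neutral_contains_not_neutral)
    then have i': "i \<in> I" "i \<notin> J" "w (?A - {i}) \<noteq> 0" by auto
    have I': "?A - {i} \<in> subsets_of_card n d"
      using less.prems i' j sub by (intro swap_subsets_of_card) auto
    have "(I, ?A - {i}) \<in> adjacent n d w"
      using less.prems i' j I' unfolding adjacent_def by blast
    moreover have "(?A - {i}, J) \<in> (adjacent n d w)\<^sup>*"
      using less.hyps[OF _ I' i'(3)] card_Diff_swap[OF fin(2) i'(2) j] by blast
    ultimately show ?thesis by (rule converse_rtrancl_into_rtrancl)
  qed
qed

text \<open>
  The relations in degree \<open>d\<close> of the Grassmann algebra of \<open>Q\<^sub>w\<close>: the exchange relations with the
  squarefree monomials themselves in place of the values of \<open>u\<close>.
\<close>

locale bent_semimodule = generated_semimodule M n g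
  for M :: "('s::idempotent_semifield, 'm, 'r) module_scheme" (structure) and n g +
  fixes d :: nat and w :: "nat set \<Rightarrow> 's"
  assumes exchange: "\<lbrakk>A \<in> subsets_of_card n (Suc d); B \<subseteq> {1..n}; card B + 1 = d; p \<in> A - B\<rbrakk> \<Longrightarrow>
    (\<Sum>i\<in>A - B. Poly_Mapping.single 0 (w (A - {i})) * gmono (B \<union> {i}))
    \<approx> (\<Sum>i\<in>A - B - {p}. Poly_Mapping.single 0 (w (A - {i})) * gmono (B \<union> {i}))"
begin

text \<open>
  For neighbours \<open>I\<close> and \<open>J\<close> there is a relation with only two terms. Either of them may be
  dropped, so both are equal to the sum.
\<close>

lemma adjacent_proportional:
  assumes "(I, J) \<in> adjacent n d w"
  shows "Poly_Mapping.single 0 (w I) * gmono J \<approx> Poly_Mapping.single 0 (w J) * gmono I"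
proof -
  obtain i j where I: "I \<in> subsets_of_card n d" and J: "J \<in> subsets_of_card n d"
    and ij: "i \<in> I" "j \<notin> I" "J = insert j I - {i}"
    using assms unfolding adjacent_def by blast
  have fin: "finite I" using I by (auto intro: finite_subset)
  let ?A = "insert j I" and ?B = "I - {i}"
  have AB: "?A - ?B = {i, j}" using ij by auto
  have j: "j \<in> {1..n}" using J ij by auto
  have A: "?A \<in> subsets_of_card n (Suc d)" using I j ij fin by auto
  have B: "?B \<subseteq> {1..n}" "card ?B + 1 = d" using I card_remove_plus1[OF fin ij(1)] by blast+
  have sets: "?A - {i} = J" "?A - {j} = I" "?B \<union> {i} = I" "?B \<union> {j} = J" "i \<noteq> j"
    using ij by auto
  have "(\<Sum>i\<in>?A - ?B. Poly_Mapping.single 0 (w (?A - {i})) * gmono (?B \<union> {i}))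
    \<approx> Poly_Mapping.single 0 (w I) * gmono J"
    using exchange[OF A B, of i] sets unfolding AB by (simp add: insert_Diff_if)
  moreover have "(\<Sum>i\<in>?A - ?B. Poly_Mapping.single 0 (w (?A - {i})) * gmono (?B \<union> {i}))
    \<approx> Poly_Mapping.single 0 (w J) * gmono I"
    using exchange[OF A B, of j] sets unfolding AB by (simp add: insert_Diff_if)
  ultimately show ?thesis using geq_sym geq_trans by blast
qed

lemma gmono_subsets_of_card: "K \<in> subsets_of_card n k \<Longrightarrow> gmono K \<in> homogeneous M k"
  using gmono_homogeneous by blast

lemma geq_const_mult:
  "p \<approx> q \<Longrightarrow> Poly_Mapping.single 0 a * p \<approx> Poly_Mapping.single 0 a * q"
  by (rule geq_mult) auto

lemma geq_const_cancel:
  assumes "a \<noteq> 0" "p \<in> Pol" "q \<in> Pol"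
    and "Poly_Mapping.single 0 a * p \<approx> Poly_Mapping.single 0 a * q"
  shows "p \<approx> q"
proof -
  obtain b where b: "a * b = 1" using ex_mult_inverse[OF assms(1)] by blast
  have "Poly_Mapping.single 0 b * (Poly_Mapping.single 0 a * r) = r" for r :: "'m multiset \<Rightarrow>\<^sub>0 's"
    using b by (simp add: mult_single mult.commute[of b] flip: mult.assoc)
  then show ?thesis using geq_const_mult[OF assms(4), of b] by simp
qed

lemma chain_proportional:
  assumes "(I, J) \<in> (adjacent n d w)\<^sup>*" and I: "I \<in> subsets_of_card n d"
  shows "Poly_Mapping.single 0 (w I) * gmono J \<approx> Poly_Mapping.single 0 (w J) * gmono I"
  using assms(1)
proof (induction rule: rtrancl_induct)
  case base
  then show ?case using I gmono_Pol by blast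
next
  case (step J K)
  have J: "w J \<noteq> 0" "J \<subseteq> {1..n}" "K \<subseteq> {1..n}" using step(2) by (auto simp: adjacent_def)
  let ?c = "\<lambda>I. Poly_Mapping.single 0 (w I) :: 'm multiset \<Rightarrow>\<^sub>0 's"
  have "?c J * (?c I * gmono K) = ?c I * (?c J * gmono K)" by (simp only: mult_ac)
  also have "\<dots> \<approx> ?c I * (?c K * gmono J)"
    using adjacent_proportional[OF step(2)] by (rule geq_const_mult)
  also have "\<dots> = ?c K * (?c I * gmono J)" by (simp only: mult_ac)
  also have "\<dots> \<approx> ?c K * (?c J * gmono I)"
    using step.IH by (rule geq_const_mult)
  also have "\<dots> = ?c J * (?c K * gmono I)" by (simp only: mult_ac)
  finally show ?case
    by (rule geq_const_cancel[OF J(1), rotated 2]) (use I J in \<open>auto intro!: poly_algebra_mult gmono_Pol\<close>)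
qed

text \<open>
  Let \<open>I\<close> be as close to \<open>J\<close> as possible among the sets in the support of \<open>w\<close>. In the relation that
  exchanges an element of \<open>J\<close> into \<open>I\<close>, only the term of \<open>J\<close> has a nonzero coefficient, since every
  other one belongs to a set closer to \<open>J\<close>; and that term may be dropped.
\<close>

lemma gmono_nonbasis:
  assumes ex: "I0 \<in> subsets_of_card n d" "w I0 \<noteq> 0"
    and J: "J \<in> subsets_of_card n d" "w J = 0"
  shows "gmono J \<approx> 0"
proof -
  obtain I where I: "I \<in> subsets_of_card n d" "w I \<noteq> 0"
    and min: "\<And>I'. I' \<in> subsets_of_card n d \<Longrightarrow> w I' \<noteq> 0 \<Longrightarrow> card (J - I) \<le> card (J - I')"
    using ex ex_has_least_nat[of "\<lambda>I. I \<in> subsets_of_card n d \<and> w I \<noteq> 0" I0 "\<lambda>I. card (J - I)"] by blast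
  have fin: "finite I" "finite J" using I J by (auto intro: finite_subset)
  have "\<not> J \<subseteq> I" using fin I J by (metis (mono_tags, lifting) card_subset_eq mem_Collect_eq)
  then obtain j where j: "j \<in> J" "j \<notin> I" by blast
  let ?A = "insert j I" and ?B = "J - {j}"
  let ?t = "\<lambda>i. Poly_Mapping.single 0 (w (?A - {i})) * gmono (?B \<union> {i})"
  have A: "?A \<in> subsets_of_card n (Suc d)" "j \<in> ?A - ?B" using I J j fin by auto
  have B: "?B \<subseteq> {1..n}" "card ?B + 1 = d" using J card_remove_plus1[OF fin(2) j(1)] by blast+
  have zero: "(\<Sum>i\<in>?A - ?B - {j}. ?t i) = 0"
  proof (rule sum.neutral, rule ballI)
    fix i assume "i \<in> ?A - ?B - {j}"
    then have i: "i \<in> I" "i \<notin> J" by auto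
    have "?A - {i} \<in> subsets_of_card n d" using I i j J by (intro swap_subsets_of_card) auto
    then have "w (?A - {i}) = 0"
      using min card_Diff_swap[OF fin(2) i(2) j] leD by blast
    then show "?t i = 0" by simp
  qed
  have "(\<Sum>i\<in>?A - ?B. ?t i) = ?t j + (\<Sum>i\<in>?A - ?B - {j}. ?t i)"
    using fin A by (intro sum.remove) auto
  moreover have "?A - {j} = I" "?B \<union> {j} = J" using j by auto
  ultimately have "Poly_Mapping.single 0 (w I) * gmono J \<approx> Poly_Mapping.single 0 (w I) * 0"
    using exchange[OF A(1) B A(2)] zero by simp
  then show ?thesis
    by (rule geq_const_cancel[OF I(2), rotated 2]) (use J in \<open>auto simp: gmono_Pol\<close>)
qed

lemma gmono_proportional:
  assumes w: "exchange_relations n d w w"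
    and I: "I \<in> subsets_of_card n d" "w I \<noteq> 0" and J: "J \<in> subsets_of_card n d"
  shows "Poly_Mapping.single 0 (w I) * gmono J \<approx> Poly_Mapping.single 0 (w J) * gmono I"
proof (cases "w J = 0")
  case True
  then show ?thesis using geq_const_mult[OF gmono_nonbasis[OF I J]] by simp
next
  case False
  then show ?thesis using exchange_chain[OF w J _ I] I chain_proportional by blast
qed

text \<open>
  The values \<open>u\<close> of a linear functional \<open>h\<close> satisfy the exchange relations against \<open>w\<close>. So there are
  chains from each element of the support of \<open>w\<close> to each element of the support of \<open>u\<close>, and along a
  chain \<open>u\<close> is proportional to \<open>w\<close>. As neither of the two vanishes, their supports agree and \<open>u\<close> is
  an invertible multiple of \<open>w\<close>; the relations are homogeneous in \<open>u\<close>.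
\<close>

lemma exchange_relations_if_functional:
  fixes h :: "('m multiset \<Rightarrow>\<^sub>0 's) \<Rightarrow> 's"
  assumes cong: "\<And>p q. p \<approx> q \<Longrightarrow> p \<in> homogeneous M d \<Longrightarrow> q \<in> homogeneous M d \<Longrightarrow> h p = h q"
    and add: "\<And>p q. p \<in> homogeneous M d \<Longrightarrow> q \<in> homogeneous M d \<Longrightarrow> h (p + q) = h p + h q"
    and smult: "\<And>a p. p \<in> homogeneous M d \<Longrightarrow> h (Poly_Mapping.single 0 a * p) = a * h p"
    and J: "J \<in> subsets_of_card n d" "h (gmono J) \<noteq> 0"
    and I: "I \<in> subsets_of_card n d" "w I \<noteq> 0"
  shows "exchange_relations n d w w"
proof -
  define u where "u K = h (gmono K)" for K
  have hom: "Poly_Mapping.single 0 a * gmono K \<in> homogeneous M d" if "K \<in> subsets_of_card n d" for a K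
    using that by (intro homogeneous_smult gmono_subsets_of_card)
  have sub: "B \<union> {i} \<in> subsets_of_card n d"
    if "A \<in> subsets_of_card n (Suc d)" "B \<subseteq> {1..n}" "card B + 1 = d" "i \<in> A - B" for A B i
  proof -
    have "finite B" using that(2) by (rule finite_subset) simp
    then show ?thesis using that by auto
  qed
  have zero: "h 0 = 0" using smult[of 0 0] by simp
  have hsum: "h (\<Sum>i\<in>X. Poly_Mapping.single 0 (a i) * gmono (K i)) = (\<Sum>i\<in>X. a i * u (K i))"
    if "\<And>i. i \<in> X \<Longrightarrow> K i \<in> subsets_of_card n d" for X :: "nat set" and a K
    using that
  proof (induction X rule: infinite_finite_induct)
    case (insert i X)
    have "gmono (K i) \<in> homogeneous M d" by (intro gmono_subsets_of_card insert.prems) simp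
    then have "h (Poly_Mapping.single 0 (a i) * gmono (K i)) = a i * u (K i)"
      by (simp add: smult u_def)
    moreover have "(\<Sum>i\<in>X. Poly_Mapping.single 0 (a i) * gmono (K i)) \<in> homogeneous M d"
      using insert by (intro homogeneous_sum hom) blast
    moreover have "Poly_Mapping.single 0 (a i) * gmono (K i) \<in> homogeneous M d"
      using insert by (intro hom) blast
    ultimately show ?case using insert by (simp add: add)
  qed (simp_all add: zero)
  have wu: "exchange_relations n d w u"
    unfolding exchange_relations_def
  proof (intro allI impI ballI, elim conjE)
    fix A B p assume AB: "A \<subseteq> {1..n}" "card A = d + 1" "B \<subseteq> {1..n}" "card B + 1 = d" "p \<in> A - B"
    then have A: "A \<in> subsets_of_card n (Suc d)" by simp
    have h: "h (\<Sum>i\<in>A - B. Poly_Mapping.single 0 (w (A - {i})) * gmono (B \<union> {i}))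
        = h (\<Sum>i\<in>A - B - {p}. Poly_Mapping.single 0 (w (A - {i})) * gmono (B \<union> {i}))"
      using sub[OF A AB(3,4)] by (intro cong exchange A AB homogeneous_sum hom) blast+
    have hs: "h (\<Sum>i\<in>X. Poly_Mapping.single 0 (w (A - {i})) * gmono (B \<union> {i}))
        = (\<Sum>i\<in>X. w (A - {i}) * u (B \<union> {i}))" if "X \<subseteq> A - B" for X
      using that sub[OF A AB(3,4)] by (intro hsum) blast
    show "(\<Sum>i\<in>A - B. w (A - {i}) * u (B \<union> {i})) = (\<Sum>i\<in>A - B - {p}. w (A - {i}) * u (B \<union> {i}))"
      using h hs[of "A - B"] hs[of "A - B - {p}"] by (metis Diff_subset order_refl)
  qed
  have hmono: "h (Poly_Mapping.single 0 a * gmono K) = a * u K" if "K \<in> subsets_of_card n d" for a K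
    unfolding u_def by (intro smult gmono_subsets_of_card that)
  have ratio: "w K * u L = w L * u K"
    if K: "K \<in> subsets_of_card n d" "w K \<noteq> 0" and L: "L \<in> subsets_of_card n d" "u L \<noteq> 0" for K L
    using cong[OF chain_proportional[OF exchange_chain[OF wu L K] K(1)] hom[OF L(1)] hom[OF K(1)]]
      hmono K L by simp
  have J: "J \<in> subsets_of_card n d" "u J \<noteq> 0" using J by (simp_all add: u_def)
  have eq: "w I * u K = w K * u I" if K: "K \<in> subsets_of_card n d" for K
  proof (cases "u K = 0")
    case True
    then have "w K = 0" using ratio[OF K _ J] J(2) by (metis mult_zero_right semifield_mult_eq_0_iff)
    with True show ?thesis by simp
  next
    case False
    then show ?thesis using ratio[OF I K] by simp
  qed
  have uI: "u I \<noteq> 0" using eq[OF J(1)] I(2) J(2) by (metis mult_zero_right semifield_mult_eq_0_iff)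
  show ?thesis
    unfolding exchange_relations_def
  proof (intro allI impI ballI, elim conjE)
    fix A B p assume AB: "A \<subseteq> {1..n}" "card A = d + 1" "B \<subseteq> {1..n}" "card B + 1 = d" "p \<in> A - B"
    then have A: "A \<in> subsets_of_card n (Suc d)" by simp
    have scale: "u I * (\<Sum>i\<in>X. w (A - {i}) * w (B \<union> {i})) = w I * (\<Sum>i\<in>X. w (A - {i}) * u (B \<union> {i}))"
      if "X \<subseteq> A - B" for X
      unfolding sum_distrib_left
    proof (rule sum.cong[OF refl])
      fix i assume "i \<in> X"
      then have *: "w I * u (B \<union> {i}) = w (B \<union> {i}) * u I" using that sub[OF A AB(3,4)] eq by blast
      have "u I * (w (A - {i}) * w (B \<union> {i})) = w (A - {i}) * (w (B \<union> {i}) * u I)"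
        by (simp only: mult_ac)
      also have "\<dots> = w (A - {i}) * (w I * u (B \<union> {i}))" by (simp only: *)
      also have "\<dots> = w I * (w (A - {i}) * u (B \<union> {i}))" by (simp only: mult_ac)
      finally show "u I * (w (A - {i}) * w (B \<union> {i})) = w I * (w (A - {i}) * u (B \<union> {i}))" .
    qed
    have "(\<Sum>i\<in>A - B. w (A - {i}) * u (B \<union> {i})) = (\<Sum>i\<in>A - B - {p}. w (A - {i}) * u (B \<union> {i}))"
      using wu AB unfolding exchange_relations_def by blast
    then have "u I * (\<Sum>i\<in>A - B. w (A - {i}) * w (B \<union> {i}))
        = u I * (\<Sum>i\<in>A - B - {p}. w (A - {i}) * w (B \<union> {i}))"
      by (simp only: scale[OF order_refl] scale[OF Diff_subset])
    then show "(\<Sum>i\<in>A - B. w (A - {i}) * w (B \<union> {i})) = (\<Sum>i\<in>A - B - {p}. w (A - {i}) * w (B \<union> {i}))"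
      by (rule semifield_mult_left_cancel[OF uI])
  qed
qed

end

section \<open>Bases, coordinates and duals\<close>

(* Index sets stay in the form {1..n} in which they occur as parameters of locales. *)
declare One_nat_def [simp del]

lemma (in semimodule) smult_finsum:
  "(\<And>i. i \<in> I \<Longrightarrow> x i \<in> carrier M) \<Longrightarrow> a \<odot> (\<Oplus>i\<in>I. x i) = (\<Oplus>i\<in>I. a \<odot> x i)"
proof (induction I rule: infinite_finite_induct)
  case (insert i I)
  then have "x \<in> I \<rightarrow> carrier M" "(\<lambda>i. a \<odot> x i) \<in> I \<rightarrow> carrier M"
    "x i \<in> carrier M" "a \<odot> x i \<in> carrier M" by auto
  with insert show ?case by (simp add: smult_r_distr)
qed (simp_all add: finsum_infinite)

lemma finsum_hom:
  assumes M: "semimodule M" and N: "semimodule N"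
    and closed: "\<And>i. i \<in> I \<Longrightarrow> x i \<in> carrier M"
    and h: "\<And>x. x \<in> carrier M \<Longrightarrow> h x \<in> carrier N"
      "\<And>x y. x \<in> carrier M \<Longrightarrow> y \<in> carrier M \<Longrightarrow> h (x \<oplus>\<^bsub>M\<^esub> y) = h x \<oplus>\<^bsub>N\<^esub> h y"
      "h \<zero>\<^bsub>M\<^esub> = \<zero>\<^bsub>N\<^esub>"
  shows "h (\<Oplus>\<^bsub>M\<^esub>i\<in>I. x i) = (\<Oplus>\<^bsub>N\<^esub>i\<in>I. h (x i))"
proof -
  interpret M: semimodule M by (rule M)
  interpret N: semimodule N by (rule N)
  show ?thesis using closed
  proof (induction I rule: infinite_finite_induct)
    case (insert i I)
    then have "x \<in> I \<rightarrow> carrier M" "x i \<in> carrier M"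
      "(\<lambda>i. h (x i)) \<in> I \<rightarrow> carrier N" "h (x i) \<in> carrier N" using h by auto
    with insert show ?case by (simp add: h)
  qed (simp_all add: h M.finsum_infinite N.finsum_infinite)
qed

lemma semimodule_scalar_module: "semimodule (scalar_module :: ('s::comm_semiring_1, 's) module)"
  by (rule semimoduleI) (auto simp: scalar_module_def algebra_simps)

lemma scalar_module_simps [simp]:
  "carrier scalar_module = UNIV" "add scalar_module = (+)" "zero scalar_module = 0"
  "smult scalar_module = (*)"
  by (simp_all add: scalar_module_def)

lemma finsum_scalar_module:
  "(\<Oplus>\<^bsub>scalar_module\<^esub>i\<in>I. x i) = (\<Sum>i\<in>I. x i :: 's::comm_semiring_1)"
proof -
  interpret semimodule "scalar_module :: ('s, 's) module" by (rule semimodule_scalar_module)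
  show ?thesis by (induction I rule: infinite_finite_induct) (auto simp: finsum_infinite)
qed

lemma scalar_functional_finsum:
  assumes M: "semimodule M" and closed: "\<And>i. i \<in> I \<Longrightarrow> x i \<in> carrier M"
    and h: "\<And>x y. x \<in> carrier M \<Longrightarrow> y \<in> carrier M \<Longrightarrow> h (x \<oplus>\<^bsub>M\<^esub> y) = h x + h y"
      "\<And>a x. x \<in> carrier M \<Longrightarrow> h (a \<odot>\<^bsub>M\<^esub> x) = a * h x"
  shows "h (\<Oplus>\<^bsub>M\<^esub>i\<in>I. a i \<odot>\<^bsub>M\<^esub> x i) = (\<Sum>i\<in>I. a i * (h (x i) :: 's::comm_semiring_1))"
proof -
  interpret M: semimodule M by (rule M)
  have "h (0 \<odot>\<^bsub>M\<^esub> \<zero>\<^bsub>M\<^esub>) = 0 * h \<zero>\<^bsub>M\<^esub>" using h(2) M.zero_closed by blast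
  then have "h \<zero>\<^bsub>M\<^esub> = 0" by simp
  then have "h (\<Oplus>\<^bsub>M\<^esub>i\<in>I. a i \<odot>\<^bsub>M\<^esub> x i) = (\<Oplus>\<^bsub>scalar_module\<^esub>i\<in>I. h (a i \<odot>\<^bsub>M\<^esub> x i))"
    using closed h by (intro finsum_hom[OF M semimodule_scalar_module]) auto
  also have "\<dots> = (\<Sum>i\<in>I. a i * h (x i))"
    unfolding finsum_scalar_module by (rule sum.cong) (auto simp: h closed)
  finally show ?thesis .
qed

locale based_semimodule = semimodule M
  for M :: "('s::comm_semiring_1, 'm, 'r) module_scheme" (structure) +
  fixes I :: "'i set" and b :: "'i \<Rightarrow> 'm"
  assumes basis: "finite_basis M I b"
begin

abbreviation "coord \<equiv> coords M I b"

lemma basis_finite: "finite I" and basis_closed: "i \<in> I \<Longrightarrow> b i \<in> carrier M"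
  using basis by (auto simp: finite_basis_def)

lemma coord_expand:
  assumes "x \<in> carrier M"
  shows "(\<Oplus>i\<in>I. coord x i \<odot> b i) = x" and "coord x \<in> extensional I"
proof -
  have "\<exists>!c. c \<in> extensional I \<and> x = (\<Oplus>i\<in>I. c i \<odot> b i)"
    using basis assms unfolding finite_basis_def by blast
  from theI'[OF this] show "(\<Oplus>i\<in>I. coord x i \<odot> b i) = x" "coord x \<in> extensional I"
    unfolding coords_def by auto
qed

lemma coord_eqI:
  assumes "x = (\<Oplus>i\<in>I. c i \<odot> b i)" and "i \<in> I"
  shows "coord x i = c i"
proof -
  have x: "x \<in> carrier M" using assms basis_closed by auto
  have "(\<Oplus>i\<in>I. restrict c I i \<odot> b i) = (\<Oplus>i\<in>I. c i \<odot> b i)"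
    using basis_closed by (intro finsum_cong') auto
  then have "x = (\<Oplus>i\<in>I. restrict c I i \<odot> b i)" using assms by simp
  moreover have "\<exists>!c. c \<in> extensional I \<and> x = (\<Oplus>i\<in>I. c i \<odot> b i)"
    using basis x unfolding finite_basis_def by blast
  ultimately have "coord x = restrict c I"
    using coord_expand[OF x] by (metis restrict_extensional)
  then show ?thesis using assms by simp
qed

lemma coord_add:
  assumes "x \<in> carrier M" "y \<in> carrier M" "i \<in> I"
  shows "coord (x \<oplus> y) i = coord x i + coord y i"
proof (rule coord_eqI[OF _ assms(3)])
  have cl: "(\<lambda>i. coord x i \<odot> b i) \<in> I \<rightarrow> carrier M" "(\<lambda>i. coord y i \<odot> b i) \<in> I \<rightarrow> carrier M"
    using basis_closed by auto
  have "x \<oplus> y = (\<Oplus>i\<in>I. coord x i \<odot> b i) \<oplus> (\<Oplus>i\<in>I. coord y i \<odot> b i)"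
    using assms coord_expand by simp
  also have "\<dots> = (\<Oplus>i\<in>I. coord x i \<odot> b i \<oplus> coord y i \<odot> b i)"
    using cl by (rule finsum_addf[symmetric])
  also have "\<dots> = (\<Oplus>i\<in>I. (coord x i + coord y i) \<odot> b i)"
    using basis_closed by (intro finsum_cong') (auto simp: smult_l_distr)
  finally show "x \<oplus> y = (\<Oplus>i\<in>I. (coord x i + coord y i) \<odot> b i)" .
qed

lemma coord_smult:
  assumes "x \<in> carrier M" "i \<in> I"
  shows "coord (a \<odot> x) i = a * coord x i"
proof (rule coord_eqI[OF _ assms(2)])
  have "a \<odot> x = a \<odot> (\<Oplus>i\<in>I. coord x i \<odot> b i)" using assms coord_expand by simp
  also have "\<dots> = (\<Oplus>i\<in>I. a \<odot> (coord x i \<odot> b i))" using basis_closed by (intro smult_finsum) auto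
  also have "\<dots> = (\<Oplus>i\<in>I. (a * coord x i) \<odot> b i)"
    using basis_closed by (intro finsum_cong') (auto simp: smult_assoc)
  finally show "a \<odot> x = (\<Oplus>i\<in>I. (a * coord x i) \<odot> b i)" .
qed

lemma finsum_delta:
  assumes "j \<in> I"
  shows "(\<Oplus>i\<in>I. (if i = j then 1 else 0) \<odot> b i) = b j"
proof -
  have "(\<Oplus>i\<in>I. (if i = j then 1 else 0) \<odot> b i) = (\<Oplus>i\<in>I. if j = i then b i else \<zero>)"
    using basis_closed by (intro finsum_cong') auto
  also have "\<dots> = b j"
    using assms basis_finite basis_closed by (intro add.finprod_singleton) auto
  finally show ?thesis .
qed

lemma coord_basis: "j \<in> I \<Longrightarrow> i \<in> I \<Longrightarrow> coord (b j) i = (if i = j then 1 else 0)"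
  by (rule coord_eqI) (simp_all add: finsum_delta)

lemma dual_carrier:
  "h \<in> carrier (dual M) \<longleftrightarrow> h \<in> extensional (carrier M) \<and>
     (\<forall>x\<in>carrier M. \<forall>y\<in>carrier M. h (x \<oplus> y) = h x + h y) \<and>
     (\<forall>a. \<forall>x\<in>carrier M. h (a \<odot> x) = a * h x)"
  by (auto simp: dual_def semimodule_hom_def)

lemma dual_expand:
  assumes "h \<in> carrier (dual M)" "x \<in> carrier M"
  shows "h x = (\<Sum>i\<in>I. coord x i * h (b i))"
proof -
  have "h (\<Oplus>i\<in>I. coord x i \<odot> b i) = (\<Sum>i\<in>I. coord x i * h (b i))"
    by (rule scalar_functional_finsum[OF semimodule_axioms])
      (use assms basis_closed in \<open>auto simp: dual_carrier\<close>)
  then show ?thesis using coord_expand assms by simp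
qed

lemma dual_eqI:
  assumes "f \<in> carrier (dual M)" "h \<in> carrier (dual M)" "\<And>i. i \<in> I \<Longrightarrow> f (b i) = h (b i)"
  shows "f = h"
proof (rule extensionalityI[of _ "carrier M"])
  fix x assume "x \<in> carrier M"
  then show "f x = h x" using assms by (simp add: dual_expand)
qed (use assms in \<open>auto simp: dual_carrier\<close>)

lemma coord_dual: "i \<in> I \<Longrightarrow> (\<lambda>x\<in>carrier M. coord x i) \<in> carrier (dual M)"
  by (auto simp: dual_carrier coord_add coord_smult)

end

lemma dual_simps:
  "x \<in> carrier M \<Longrightarrow> (f \<oplus>\<^bsub>dual M\<^esub> h) x = f x + h x"
  "x \<in> carrier M \<Longrightarrow> (a \<odot>\<^bsub>dual M\<^esub> f) x = a * f x"
  "x \<in> carrier M \<Longrightarrow> \<zero>\<^bsub>dual M\<^esub> x = 0"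
  by (simp_all add: dual_def)

context semimodule
begin

lemma semimodule_dual: "semimodule (dual M)"
  by (rule semimoduleI)
    (auto simp: dual_def semimodule_hom_def algebra_simps restrict_def extensional_def fun_eq_iff
      smult_r_distr smult_assoc)

lemma dual_finsum:
  assumes "\<And>i. i \<in> I \<Longrightarrow> f i \<in> carrier (dual M)" "x \<in> carrier M"
  shows "(\<Oplus>\<^bsub>dual M\<^esub>i\<in>I. f i) x = (\<Sum>i\<in>I. f i x)"
proof -
  have "(\<lambda>f. f x) (\<Oplus>\<^bsub>dual M\<^esub>i\<in>I. f i) = (\<Oplus>\<^bsub>scalar_module\<^esub>i\<in>I. f i x)"
    by (rule finsum_hom[OF semimodule_dual semimodule_scalar_module])
      (use assms in \<open>auto simp: dual_simps\<close>)
  then show ?thesis by (simp add: finsum_scalar_module)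
qed

end

lemma quotient_by_finsum:
  assumes M: "semimodule M" and R: "module_congruence M R" and "\<And>i. i \<in> I \<Longrightarrow> x i \<in> carrier M"
  shows "R `` {\<Oplus>\<^bsub>M\<^esub>i\<in>I. x i} = (\<Oplus>\<^bsub>quotient_by M R\<^esub>i\<in>I. R `` {x i})"
  by (rule finsum_hom[OF M quotient_by_semimodule[OF M R]])
    (use assms in \<open>auto simp: quotient_by_add quotient_by_simps quotientI\<close>)

locale free_semimodule = based_semimodule V "{1..n}" e
  for V :: "('s::comm_semiring_1, 'v, 'r) module_scheme" (structure) and n :: nat and e :: "nat \<Rightarrow> 'v"
begin

sublocale generated_semimodule V n e
  by unfold_locales (rule basis_closed)

notation geq (infix \<open>\<approx>\<close> 50)

text \<open>
  With the coordinates as representatives the linearity relations hold exactly, so every function on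
  subsets gives a functional. This is what makes the squarefree monomials independent.
\<close>

sublocale alternating: alternating_functional V n e coord c for c
proof unfold_locales
  fix x y B assume x: "x \<in> carrier V" and y: "y \<in> carrier V"
  have "pairing n c (coord (x \<oplus> y)) B = pairing n c (\<lambda>i. coord x i + coord y i) B"
    by (rule pairing_cong) (rule coord_add[OF x y])
  then show "pairing n c (coord (x \<oplus> y)) B = pairing n c (coord x) B + pairing n c (coord y) B"
    by (simp only: pairing_add)
next
  fix x a B assume x: "x \<in> carrier V"
  have "pairing n c (coord (a \<odot> x)) B = pairing n c (\<lambda>i. a * coord x i) B"
    by (rule pairing_cong) (rule coord_smult[OF x])
  then show "pairing n c (coord (a \<odot> x)) B = a * pairing n c (coord x) B"
    by (simp only: pairing_smult)
next
  fix i B assume i: "i \<in> {1..n}"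
  have "pairing n c (coord (e i)) B = pairing n c (\<lambda>j. if j = i then 1 else 0) B"
    by (rule pairing_cong) (rule coord_basis[OF i])
  then show "pairing n c (coord (e i)) B = (if i \<in> B then 0 else c (insert i B))"
    by (simp only: pairing_var[OF i])
qed

lemma coefficient_functional:
  assumes I: "I \<in> subsets_of_card n d"
  shows "alternating.functional (\<lambda>J. if J = I then 1 else 0)
    (\<Sum>I\<in>subsets_of_card n d. Poly_Mapping.single 0 (a I) * gmono I) = a I"
proof -
  let ?c = "\<lambda>J. if J = I then 1 else 0"
  have "(\<Sum>J\<in>subsets_of_card n d. a J * alternating.functional ?c (gmono J))
      = (\<Sum>J\<in>subsets_of_card n d. if J = I then a I else 0)"
    by (rule sum.cong) (auto simp: alternating.functional_gmono)
  then show ?thesis using I finite_subsets_of_card[of n d]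
    by (simp add: alternating.functional_sum alternating.functional_smult)
qed

lemma coefficient_unique:
  assumes "(\<Sum>I\<in>subsets_of_card n d. Poly_Mapping.single 0 (a I) * gmono I)
      \<approx> (\<Sum>I\<in>subsets_of_card n d. Poly_Mapping.single 0 (a' I) * gmono I)"
    and I: "I \<in> subsets_of_card n d"
  shows "a I = a' I"
  using alternating.functional_cong[OF assms(1), of "\<lambda>J. if J = I then 1 else 0"]
  by (simp only: coefficient_functional[OF I])

lemma proj_expansion:
  "proj (\<Sum>I\<in>subsets_of_card n d. Poly_Mapping.single 0 (a I) * gmono I)
    = (\<Oplus>\<^bsub>ext_power V n e d\<^esub>I\<in>subsets_of_card n d.
        a I \<odot>\<^bsub>ext_power V n e d\<^esub> wedge_monomial V n e I)"
proof -
  have "proj (\<Sum>I\<in>subsets_of_card n d. Poly_Mapping.single 0 (a I) * gmono I)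
    = (\<Oplus>\<^bsub>ext_power V n e d\<^esub>I\<in>subsets_of_card n d. proj (Poly_Mapping.single 0 (a I) * gmono I))"
    by (rule proj_sum) (auto intro!: homogeneous_smult gmono_homogeneous)
  also have "\<dots> = (\<Oplus>\<^bsub>ext_power V n e d\<^esub>I\<in>subsets_of_card n d.
        a I \<odot>\<^bsub>ext_power V n e d\<^esub> wedge_monomial V n e I)"
  proof -
    interpret E: semimodule "ext_power V n e d" by (rule semimodule_ext_power)
    show ?thesis
      by (rule E.finsum_cong')
        (auto simp: proj_smult gmono_Pol wedge_monomial_eq gmono_homogeneous
          intro!: E.smult_closed[simplified] proj_homogeneous)
  qed
  finally show ?thesis .
qed

lemma homogeneous_expand:
  assumes "p \<in> homogeneous V d"
  obtains a where "p \<approx> (\<Sum>I\<in>subsets_of_card n d. Poly_Mapping.single 0 (a I) * gmono I)"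
proof -
  have "in_span d p"
    by (rule homogeneous_in_span[OF _ assms]) (metis coord_expand(1))
  then show ?thesis using that by (auto simp: in_span_def)
qed

text \<open>
  Expanding gives existence of coordinates; their uniqueness is read off from the functionals that
  single out one squarefree monomial.
\<close>

lemma ext_power_basis:
  "finite_basis (ext_power V n e d) (subsets_of_card n d) (wedge_monomial V n e)"
  unfolding finite_basis_def
proof (intro conjI ballI)
  show "finite (subsets_of_card n d)" by (rule finite_subsets_of_card)
  show "wedge_monomial V n e \<in> subsets_of_card n d \<rightarrow> carrier (ext_power V n e d)"
    by (auto simp: wedge_monomial_eq gmono_homogeneous intro!: proj_homogeneous)
  fix x assume "x \<in> carrier (ext_power V n e d)"
  then obtain p where p: "p \<in> homogeneous V d" "x = proj p" by (auto simp: ext_power_carrier)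
  obtain a where a: "p \<approx> (\<Sum>I\<in>subsets_of_card n d. Poly_Mapping.single 0 (a I) * gmono I)"
    using homogeneous_expand[OF p(1)] .
  let ?x = "\<lambda>a. \<Oplus>\<^bsub>ext_power V n e d\<^esub>I\<in>subsets_of_card n d.
        a I \<odot>\<^bsub>ext_power V n e d\<^esub> wedge_monomial V n e I"
  have xa: "x = ?x a" using a p by (simp add: geq_def proj_expansion)
  have "?x (restrict a (subsets_of_card n d)) = ?x a"
  proof -
    interpret E: semimodule "ext_power V n e d" by (rule semimodule_ext_power)
    show ?thesis
      by (rule E.finsum_cong') 
        (auto simp: wedge_monomial_eq gmono_homogeneous intro!: E.smult_closed[simplified] proj_homogeneous)
  qed
  moreover have "c = c'" if c: "c \<in> extensional (subsets_of_card n d)"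
    "c' \<in> extensional (subsets_of_card n d)" "?x c = ?x c'" for c c'
  proof (rule extensionalityI[OF c(1,2)])
    fix I assume I: "I \<in> subsets_of_card n d"
    have "(\<Sum>I\<in>subsets_of_card n d. Poly_Mapping.single 0 (c I) * gmono I)
      \<approx> (\<Sum>I\<in>subsets_of_card n d. Poly_Mapping.single 0 (c' I) * gmono I)"
      unfolding geq_def using c(3)
      by (auto simp: proj_expansion gmono_Pol intro!: poly_algebra_sum poly_algebra_mult)
    then show "c I = c' I" using I by (rule coefficient_unique)
  qed
  ultimately show "\<exists>!c. c \<in> extensional (subsets_of_card n d) \<and> x = ?x c"
    unfolding xa by (intro ex1I[of _ "restrict a (subsets_of_card n d)"]) auto
qed

sublocale ext: based_semimodule "ext_power V n e k" "subsets_of_card n k" "wedge_monomial V n e" for k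
  by (intro based_semimodule.intro semimodule_ext_power based_semimodule_axioms.intro ext_power_basis)

lemma coord_proj:
  assumes "p \<in> homogeneous V d" and A: "A \<in> subsets_of_card n d"
  shows "ext.coord d (proj p) A = alternating.functional (\<lambda>J. if J = A then 1 else 0) p"
proof -
  obtain a where a: "p \<approx> (\<Sum>I\<in>subsets_of_card n d. Poly_Mapping.single 0 (a I) * gmono I)"
    using homogeneous_expand[OF assms(1)] .
  then have "proj p = (\<Oplus>\<^bsub>ext_power V n e d\<^esub>I\<in>subsets_of_card n d.
        a I \<odot>\<^bsub>ext_power V n e d\<^esub> wedge_monomial V n e I)"
    by (simp add: geq_def proj_expansion)
  then have "ext.coord d (proj p) A = a A" using A by (rule ext.coord_eqI)
  then show ?thesis
    by (simp only: alternating.functional_cong[OF a] coefficient_functional[OF A])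
qed

end

section \<open>The module defined by the bend relations of a vector\<close>

locale tropical_vector = free_semimodule V n e
  for V :: "('s::idempotent_semifield, 'v, 'r) module_scheme" (structure) and n e +
  fixes d :: nat and w :: "('v multiset \<Rightarrow>\<^sub>0 's) set set"
  assumes w_closed: "w \<in> carrier (ext_power V n e d)"
    and w_nonzero: "w \<noteq> \<zero>\<^bsub>ext_power V n e d\<^esub>"
begin

abbreviation W :: "nat set \<Rightarrow> 's" where "W \<equiv> wedge_coeff V n e d w"

definition wpoly :: "'v multiset \<Rightarrow>\<^sub>0 's" where
  "wpoly = (\<Sum>I\<in>subsets_of_card n d. Poly_Mapping.single 0 (W I) * gmono I)"

lemma wpoly_homogeneous: "wpoly \<in> homogeneous V d"
  unfolding wpoly_def by (auto intro!: homogeneous_sum homogeneous_smult gmono_homogeneous)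

lemma w_eq: "w = proj wpoly"
  unfolding wpoly_def proj_expansion wedge_coeff_def using ext.coord_expand[OF w_closed] by simp

lemma W_nonzero:
  obtains I where "I \<in> subsets_of_card n d" "W I \<noteq> 0"
proof -
  have "\<exists>I\<in>subsets_of_card n d. W I \<noteq> 0"
  proof (rule ccontr)
    assume "\<not> ?thesis"
    then have "wpoly = 0" unfolding wpoly_def by (intro sum.neutral) auto
    then have "w = proj 0" using w_eq by metis
    then show False using w_nonzero by (simp add: proj_zero)
  qed
  then show ?thesis using that by blast
qed

abbreviation wedge_w :: "'v \<Rightarrow> ('v multiset \<Rightarrow>\<^sub>0 's) set set" where
  "wedge_w \<equiv> wedge_map V n e w"

lemma wedge_w_eq: "v \<in> carrier V \<Longrightarrow> wedge_w v = proj (poly_var v * wpoly)"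
  using wpoly_homogeneous
  by (simp add: wedge_map_def grassmann_of_eq w_eq[symmetric] proj_mult poly_algebra_var
      homogeneous_carrier)

lemma var_wpoly_homogeneous: "v \<in> carrier V \<Longrightarrow> poly_var v * wpoly \<in> homogeneous V (d + 1)"
  using homogeneous_mult[OF homogeneous_var wpoly_homogeneous] by (simp add: add.commute)

lemmas var_wpoly_Pol = homogeneous_carrier[OF var_wpoly_homogeneous]

lemma wedge_w_closed: "v \<in> carrier V \<Longrightarrow> wedge_w v \<in> carrier (ext_power V n e (d + 1))"
  unfolding wedge_w_eq by (intro proj_homogeneous var_wpoly_homogeneous)

lemma wedge_w_add:
  assumes "u \<in> carrier V" "v \<in> carrier V"
  shows "wedge_w (u \<oplus> v) = wedge_w u \<oplus>\<^bsub>ext_power V n e k\<^esub> wedge_w v"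
proof -
  have "poly_var (u \<oplus> v) * wpoly \<approx> (poly_var u + poly_var v) * wpoly"
    using assms wpoly_homogeneous by (intro geq_mult geq_var_add geq_refl homogeneous_carrier)
  then have "proj (poly_var (u \<oplus> v) * wpoly) = proj (poly_var u * wpoly + poly_var v * wpoly)"
    by (simp add: geq_def distrib_right)
  then show ?thesis using assms
    by (simp add: wedge_w_eq proj_add var_wpoly_Pol)
qed

lemma wedge_w_smult:
  assumes "v \<in> carrier V"
  shows "wedge_w (a \<odot> v) = a \<odot>\<^bsub>ext_power V n e k\<^esub> wedge_w v"
proof -
  have "poly_var (a \<odot> v) * wpoly \<approx> (Poly_Mapping.single 0 a * poly_var v) * wpoly"
    using assms wpoly_homogeneous by (intro geq_mult geq_var_smult geq_refl homogeneous_carrier)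
  then have "proj (poly_var (a \<odot> v) * wpoly) = proj (Poly_Mapping.single 0 a * (poly_var v * wpoly))"
    by (simp add: geq_def mult.assoc)
  then show ?thesis using assms
    by (simp add: wedge_w_eq proj_smult var_wpoly_Pol)
qed

abbreviation pullback :: "(('v multiset \<Rightarrow>\<^sub>0 's) set set \<Rightarrow> 's) \<Rightarrow> 'v \<Rightarrow> 's" where
  "pullback \<equiv> dual_map V wedge_w"

lemma pullback_dual:
  assumes "h \<in> carrier (dual (ext_power V n e (d + 1)))"
  shows "pullback h \<in> carrier (dual V)"
proof -
  have h: "h (x \<oplus>\<^bsub>ext_power V n e (d + 1)\<^esub> y) = h x + h y"
    if "x \<in> carrier (ext_power V n e (d + 1))" "y \<in> carrier (ext_power V n e (d + 1))" for x y
    using assms that unfolding ext.dual_carrier by blast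
  have h': "h (a \<odot>\<^bsub>ext_power V n e (d + 1)\<^esub> x) = a * h x"
    if "x \<in> carrier (ext_power V n e (d + 1))" for x a
    using assms that unfolding ext.dual_carrier by blast
  show ?thesis unfolding dual_carrier dual_map_def
    using wedge_w_add[of _ _ "d + 1"] wedge_w_smult[of _ _ "d + 1"] h h' wedge_w_closed
    by simp
qed

text \<open>
  The coefficients of the pullback of the coordinate function at \<open>A\<close>, for \<open>A\<close> with \<open>d + 1\<close> elements.
  If \<open>w\<close> is a Pluecker vector, the nonzero ones among these linear forms are, up to scaling, the
  circuits of its valuated matroid. They span the image of the dual of \<open>- \<and> w\<close>.
\<close>

definition circuit :: "nat set \<Rightarrow> nat \<Rightarrow> 's" where
  "circuit A i = (if i \<in> A then W (A - {i}) else 0)"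

lemma coord_wedge_w:
  assumes A: "A \<in> subsets_of_card n (d + 1)" and i: "i \<in> {1..n}"
  shows "ext.coord (d + 1) (wedge_w (e i)) A = circuit A i"
proof -
  let ?f = "alternating.functional (\<lambda>J. if J = A then 1 else 0)"
  have fin: "finite A" using A by (auto intro: finite_subset)
  have ei: "e i \<in> carrier V" using i by (rule basis_closed)
  have mon: "?f (poly_var (e i) * gmono I) = (if I = A - {i} \<and> i \<in> A then 1 else 0)"
    if I: "I \<in> subsets_of_card n d" for I
  proof -
    have I': "I \<subseteq> {1..n}" using I by blast
    have "?f (poly_var (e i) * gmono I) = ?f (if i \<in> I then 0 else gmono (insert i I))"
      by (rule alternating.functional_cong[OF var_mono[OF I' i]])
    also have "\<dots> = (if i \<notin> I \<and> insert i I = A then 1 else 0)"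
    proof (cases "i \<in> I")
      case False
      have "insert i I \<subseteq> {1..n}" using I' i by simp
      then have "?f (gmono (insert i I)) = (if insert i I = A then 1 else 0)"
        by (rule alternating.functional_gmono)
      then show ?thesis using False by (simp only: if_False simp_thms)
    qed simp
    also have "\<dots> = (if I = A - {i} \<and> i \<in> A then 1 else 0)" by (rule if_cong) auto
    finally show ?thesis .
  qed
  have "ext.coord (d + 1) (wedge_w (e i)) A = ?f (poly_var (e i) * wpoly)"
    unfolding wedge_w_eq[OF ei] by (rule coord_proj[OF var_wpoly_homogeneous[OF ei] A])
  also have "poly_var (e i) * wpoly
      = (\<Sum>I\<in>subsets_of_card n d. Poly_Mapping.single 0 (W I) * (poly_var (e i) * gmono I))"
    by (simp add: wpoly_def sum_distrib_left mult_ac)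
  also have "?f \<dots> = (\<Sum>I\<in>subsets_of_card n d. W I * (if I = A - {i} \<and> i \<in> A then 1 else 0))"
    unfolding alternating.functional_sum alternating.functional_smult
    by (rule sum.cong[OF refl]) (simp only: mon)
  also have "\<dots> = (\<Sum>I\<in>subsets_of_card n d. if I = A - {i} then circuit A i else 0)"
    by (rule sum.cong) (auto simp: circuit_def)
  also have "\<dots> = circuit A i"
  proof (cases "i \<in> A")
    case True
    then have "A - {i} \<in> subsets_of_card n d" using A fin by auto
    then show ?thesis using finite_subsets_of_card[of n d] by simp
  qed (auto simp: circuit_def intro!: sum.neutral)
  finally show ?thesis .
qed

lemma pullback_expand:
  assumes h: "h \<in> carrier (dual (ext_power V n e (d + 1)))" and i: "i \<in> {1..n}"
  shows "pullback h (e i)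
    = (\<Sum>A\<in>subsets_of_card n (d + 1). circuit A i * h (wedge_monomial V n e A))"
proof -
  have ei: "e i \<in> carrier V" using i by (rule basis_closed)
  then have "pullback h (e i) = h (wedge_w (e i))" by (simp add: dual_map_def)
  also have "\<dots> = (\<Sum>A\<in>subsets_of_card n (d + 1). circuit A i * h (wedge_monomial V n e A))"
    unfolding ext.dual_expand[OF h wedge_w_closed[OF ei]]
    by (rule sum.cong[OF refl]) (simp only: coord_wedge_w[OF _ i])
  finally show ?thesis .
qed

lemma circuit_pullback:
  assumes A: "A \<in> subsets_of_card n (d + 1)"
  obtains h where "h \<in> carrier (dual (ext_power V n e (d + 1)))"
    "\<And>i. i \<in> {1..n} \<Longrightarrow> pullback h (e i) = circuit A i"
proof
  let ?h = "\<lambda>x\<in>carrier (ext_power V n e (d + 1)). ext.coord (d + 1) x A"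
  show "?h \<in> carrier (dual (ext_power V n e (d + 1)))" by (rule ext.coord_dual[OF A])
  fix i assume i: "i \<in> {1..n}"
  then have "e i \<in> carrier V" by (rule basis_closed)
  then show "pullback ?h (e i) = circuit A i"
    using coord_wedge_w[OF A i] wedge_w_closed by (simp add: dual_map_def)
qed

lemma dual_basis_dual: "i \<in> {1..n} \<Longrightarrow> dual_basis V n e i \<in> carrier (dual V)"
  unfolding dual_basis_def by (rule coord_dual)

lemma dual_basis_eval: "i \<in> {1..n} \<Longrightarrow> j \<in> {1..n} \<Longrightarrow> dual_basis V n e i (e j) = (if i = j then 1 else 0)"
  by (simp add: dual_basis_def basis_closed coord_basis)

abbreviation combination :: "nat set \<Rightarrow> (nat \<Rightarrow> 's) \<Rightarrow> 'v \<Rightarrow> 's" where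
  "combination X f \<equiv> (\<Oplus>\<^bsub>dual V\<^esub>i\<in>X. f i \<odot>\<^bsub>dual V\<^esub> dual_basis V n e i)"

lemma combination_dual:
  assumes "X \<subseteq> {1..n}"
  shows "combination X f \<in> carrier (dual V)"
proof -
  interpret D: semimodule "dual V" by (rule semimodule_dual)
  show ?thesis using assms dual_basis_dual by (intro D.finsum_closed) auto
qed

lemma combination_eval:
  assumes X: "X \<subseteq> {1..n}" and j: "j \<in> {1..n}"
  shows "combination X f (e j) = (if j \<in> X then f j else 0)"
proof -
  interpret D: semimodule "dual V" by (rule semimodule_dual)
  have ej: "e j \<in> carrier V" using j by (rule basis_closed)
  have fin: "finite X" using X by (rule finite_subset) simp
  have "combination X f (e j) = (\<Sum>i\<in>X. (f i \<odot>\<^bsub>dual V\<^esub> dual_basis V n e i) (e j))"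
    using X dual_basis_dual by (intro dual_finsum ej D.smult_closed) auto
  also have "\<dots> = (\<Sum>i\<in>X. if i = j then f j else 0)"
    using X j by (intro sum.cong) (auto simp: dual_simps ej dual_basis_eval subset_iff)
  finally show ?thesis using fin by simp
qed

lemma dual_eq_combination:
  assumes "f \<in> carrier (dual V)"
  shows "f = combination {1..n} (\<lambda>i. f (e i))"
  by (rule dual_eqI[OF assms combination_dual]) (simp_all add: combination_eval)

abbreviation Qc :: "(('v \<Rightarrow> 's) \<times> ('v \<Rightarrow> 's)) set" where
  "Qc \<equiv> Q_congruence V n e d w"

lemma Qc_generators:
  "Qc = gen_module_congruence (dual V)
    {(pullback h, combination ({1..n} - {j}) (\<lambda>i. pullback h (e i))) | h j.
      h \<in> carrier (dual (ext_power V n e (d + 1))) \<and> j \<in> {1..n}}"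
proof -
  have "(\<Union>f\<in>pullback ` carrier (dual (ext_power V n e (d + 1))). bend_relations V n e f)
    = {(pullback h, combination ({1..n} - {j}) (\<lambda>i. pullback h (e i))) | h j.
      h \<in> carrier (dual (ext_power V n e (d + 1))) \<and> j \<in> {1..n}}"
    unfolding bend_relations_def by blast
  then show ?thesis unfolding Q_congruence_def bend_congruence_def by simp
qed

lemma Qc_congruence: "module_congruence (dual V) Qc"
  unfolding Qc_generators
  by (rule gen_module_congruence[OF semimodule_dual]) (auto intro!: pullback_dual combination_dual)

lemma Qc_bend:
  "h \<in> carrier (dual (ext_power V n e (d + 1))) \<Longrightarrow> j \<in> {1..n} \<Longrightarrow>
    (pullback h, combination ({1..n} - {j}) (\<lambda>i. pullback h (e i))) \<in> Qc"
  unfolding Qc_generators by (rule subsetD[OF gen_module_congruence_incl]) blast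

abbreviation Q :: "('s, ('v \<Rightarrow> 's) set) module" where "Q \<equiv> Q_module V n e d w"
abbreviation q :: "nat \<Rightarrow> ('v \<Rightarrow> 's) set" where "q \<equiv> Q_gen V n e d w"

lemma semimodule_Q: "semimodule Q"
  unfolding Q_module_def by (rule quotient_by_semimodule[OF semimodule_dual Qc_congruence])

lemma Q_gen_closed: "i \<in> {1..n} \<Longrightarrow> q i \<in> carrier Q"
  unfolding Q_module_def Q_gen_def by (intro quotient_by_class dual_basis_dual)

lemma Q_combination:
  assumes X: "X \<subseteq> {1..n}"
  shows "Qc `` {combination X f} = (\<Oplus>\<^bsub>Q\<^esub>i\<in>X. f i \<odot>\<^bsub>Q\<^esub> q i)"
proof -
  interpret D: semimodule "dual V" by (rule semimodule_dual)
  interpret Q: semimodule Q by (rule semimodule_Q)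
  have "Qc `` {combination X f} = (\<Oplus>\<^bsub>Q\<^esub>i\<in>X. Qc `` {f i \<odot>\<^bsub>dual V\<^esub> dual_basis V n e i})"
    unfolding Q_module_def using X dual_basis_dual
    by (intro quotient_by_finsum semimodule_dual Qc_congruence D.smult_closed) auto
  also have "\<dots> = (\<Oplus>\<^bsub>Q\<^esub>i\<in>X. f i \<odot>\<^bsub>Q\<^esub> q i)"
  proof (rule Q.finsum_cong'[OF refl])
    show "(\<lambda>i. f i \<odot>\<^bsub>Q\<^esub> q i) \<in> X \<rightarrow> carrier Q" using X Q_gen_closed by auto
    fix i assume "i \<in> X"
    then have "dual_basis V n e i \<in> carrier (dual V)" using X dual_basis_dual by blast
    then show "Qc `` {f i \<odot>\<^bsub>dual V\<^esub> dual_basis V n e i} = f i \<odot>\<^bsub>Q\<^esub> q i"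
      unfolding Q_module_def Q_gen_def by (rule quotient_by_smult[OF Qc_congruence, symmetric])
  qed
  finally show ?thesis .
qed

sublocale Q: generated_semimodule Q n q
  by (intro generated_semimodule.intro semimodule_Q generated_semimodule_axioms.intro Q_gen_closed)

notation Q.geq (infix \<open>\<approx>\<^sub>Q\<close> 50)

lemma Q_span:
  assumes "X \<in> carrier Q"
  shows "\<exists>a. X = (\<Oplus>\<^bsub>Q\<^esub>i\<in>{1..n}. a i \<odot>\<^bsub>Q\<^esub> q i)"
proof -
  obtain f where f: "f \<in> carrier (dual V)" "X = Qc `` {f}"
    using assms by (auto simp: Q_module_def quotient_by_simps elim: quotientE)
  have "X = Qc `` {combination {1..n} (\<lambda>i. f (e i))}"
    using f dual_eq_combination[OF f(1)] by simp
  then show ?thesis by (auto simp: Q_combination)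
qed

text \<open>
  In \<open>Q\<^sub>w\<close> the two sides of a bend relation are the same element, and its variable can be expanded
  along either of them.
\<close>

lemma Q_circuit:
  assumes A: "A \<in> subsets_of_card n (d + 1)" and p: "p \<in> {1..n}"
  shows "(\<Sum>i\<in>{1..n}. Poly_Mapping.single 0 (circuit A i) * poly_var (q i))
    \<approx>\<^sub>Q (\<Sum>i\<in>{1..n} - {p}. Poly_Mapping.single 0 (circuit A i) * poly_var (q i))"
proof -
  obtain h where h: "h \<in> carrier (dual (ext_power V n e (d + 1)))"
    "\<And>i. i \<in> {1..n} \<Longrightarrow> pullback h (e i) = circuit A i"
    using circuit_pullback[OF A] by blast
  let ?f = "\<lambda>i. pullback h (e i)"
  have var: "(\<Sum>i\<in>X. Poly_Mapping.single 0 (circuit A i) * poly_var (q i))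
      \<approx>\<^sub>Q poly_var (Qc `` {combination X ?f})" if X: "X \<subseteq> {1..n}" for X
  proof -
    have fin: "finite X" using X by (rule finite_subset) simp
    have "poly_var (\<Oplus>\<^bsub>Q\<^esub>i\<in>X. ?f i \<odot>\<^bsub>Q\<^esub> q i) \<approx>\<^sub>Q (\<Sum>i\<in>X. Poly_Mapping.single 0 (?f i) * poly_var (q i))"
      using X by (intro Q.geq_var_finsum fin Q_gen_closed) blast
    also have "(\<Sum>i\<in>X. Poly_Mapping.single 0 (?f i) * poly_var (q i))
        = (\<Sum>i\<in>X. Poly_Mapping.single 0 (circuit A i) * poly_var (q i))"
      using X h(2) by (intro sum.cong) auto
    finally show ?thesis unfolding Q_combination[OF X] by (rule Q.geq_sym)
  qed
  have "(combination {1..n} ?f, combination ({1..n} - {p}) ?f) \<in> Qc"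
    using Qc_bend[OF h(1) p]
    by (simp only: dual_eq_combination[OF pullback_dual[OF h(1)], symmetric])
  then have eq: "Qc `` {combination {1..n} ?f} = Qc `` {combination ({1..n} - {p}) ?f}"
    by (rule equiv_class_eq[OF module_congruence_equiv[OF Qc_congruence]])
  show ?thesis
    using Q.geq_trans[OF var[OF order_refl, unfolded eq] Q.geq_sym[OF var[OF Diff_subset]]] .
qed

text \<open>
  The relation for \<open>A\<close>, \<open>B\<close> and \<open>p\<close> is the bend relation of the circuit of \<open>A\<close> at \<open>p\<close>, multiplied by
  the monomial of \<open>B\<close>, which kills the terms with \<open>i \<in> B\<close>.
\<close>

sublocale Q: bent_semimodule Q n q d W
proof unfold_locales
  fix A B p
  assume A: "A \<in> subsets_of_card n (Suc d)" and B: "B \<subseteq> {1..n}" "card B + 1 = d" and p: "p \<in> A - B"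
  let ?c = "\<lambda>i. Poly_Mapping.single 0 (circuit A i)"
  have expand: "(\<Sum>i\<in>X. ?c i * poly_var (q i)) * Q.gmono B
      \<approx>\<^sub>Q (\<Sum>i\<in>X \<inter> (A - B). Poly_Mapping.single 0 (W (A - {i})) * Q.gmono (B \<union> {i}))"
    if X: "X \<subseteq> {1..n}" for X
  proof -
    have fin: "finite X" using X by (rule finite_subset) simp
    have e1: "(\<Sum>i\<in>X. ?c i * poly_var (q i)) * Q.gmono B = (\<Sum>i\<in>X. ?c i * (poly_var (q i) * Q.gmono B))"
      by (simp add: sum_distrib_right mult.assoc)
    have e2: "(\<Sum>i\<in>X. ?c i * (poly_var (q i) * Q.gmono B))
        \<approx>\<^sub>Q (\<Sum>i\<in>X. ?c i * (if i \<in> B then 0 else Q.gmono (insert i B)))"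
    proof (rule Q.geq_sum)
      fix i assume "i \<in> X"
      then have "i \<in> {1..n}" using X by blast
      from Q.geq_mult[OF Q.geq_refl[OF poly_algebra_const] Q.var_mono[OF B(1) this]]
      show "?c i * (poly_var (q i) * Q.gmono B)
          \<approx>\<^sub>Q ?c i * (if i \<in> B then 0 else Q.gmono (insert i B))" .
    qed
    have e3: "(\<Sum>i\<in>X. ?c i * (if i \<in> B then 0 else Q.gmono (insert i B)))
        = (\<Sum>i\<in>X \<inter> (A - B). Poly_Mapping.single 0 (W (A - {i})) * Q.gmono (B \<union> {i}))"
    proof (rule sum.mono_neutral_cong_right[OF fin])
      show "\<forall>i\<in>X - X \<inter> (A - B). ?c i * (if i \<in> B then 0 else Q.gmono (insert i B)) = 0"
        by (simp add: circuit_def)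
      show "?c i * (if i \<in> B then 0 else Q.gmono (insert i B))
          = Poly_Mapping.single 0 (W (A - {i})) * Q.gmono (B \<union> {i})" if "i \<in> X \<inter> (A - B)" for i
        using that by (simp add: circuit_def)
    qed blast
    show ?thesis using e2 unfolding e1 e3 .
  qed
  have p': "p \<in> {1..n}" using A p by blast
  have sets: "{1..n} \<inter> (A - B) = A - B" "({1..n} - {p}) \<inter> (A - B) = A - B - {p}" using A by auto
  have A': "A \<in> subsets_of_card n (d + 1)" using A by simp
  have "(\<Sum>i\<in>{1..n}. ?c i * poly_var (q i)) * Q.gmono B
      \<approx>\<^sub>Q (\<Sum>i\<in>{1..n} - {p}. ?c i * poly_var (q i)) * Q.gmono B"
    using Q_circuit[OF A' p'] by (rule Q.geq_mult) (rule Q.geq_refl[OF Q.gmono_Pol[OF B(1)]])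
  from Q.geq_trans[OF Q.geq_sym[OF expand[OF order_refl]] Q.geq_trans[OF this expand[OF Diff_subset]]]
  show "(\<Sum>i\<in>A - B. Poly_Mapping.single 0 (W (A - {i})) * Q.gmono (B \<union> {i}))
    \<approx>\<^sub>Q (\<Sum>i\<in>A - B - {p}. Poly_Mapping.single 0 (W (A - {i})) * Q.gmono (B \<union> {i}))"
    unfolding sets .
qed

section \<open>The functional of a Pluecker vector\<close>

text \<open>
  Pluecker coordinates, extended by \<open>0\<close> to the subsets of the wrong size: the functional to be
  constructed vanishes outside degree \<open>d\<close>.
\<close>

definition Wd :: "nat set \<Rightarrow> 's" where
  "Wd I = (if card I = d then W I else 0)"

text \<open>
  Here the Pluecker relations enter. They say that the functional given by \<open>w\<close> does not see the
  omission of a term from a circuit that has been multiplied by the monomial of \<open>B\<close>.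
\<close>

lemma pairing_circuit:
  assumes rel: "exchange_relations n d W W"
    and A: "A \<in> subsets_of_card n (d + 1)" and B: "B \<subseteq> {1..n}"
  shows "pairing n Wd (\<lambda>i. if i = j then 0 else circuit A i) B = pairing n Wd (circuit A) B"
proof (cases "card B + 1 = d")
  case True
  have finB: "finite B" using B by (rule finite_subset) simp
  have eval: "pairing n Wd (\<lambda>i. if i \<in> Y then 0 else circuit A i) B
      = (\<Sum>i\<in>A - B - Y. W (A - {i}) * W (B \<union> {i}))" for Y
    unfolding pairing_def using A finB True
    by (intro sum.mono_neutral_cong_right) (auto simp: circuit_def Wd_def)
  have "(\<Sum>i\<in>A - B - {j}. W (A - {i}) * W (B \<union> {i})) = (\<Sum>i\<in>A - B. W (A - {i}) * W (B \<union> {i}))"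
  proof (cases "j \<in> A - B")
    case True
    then have "(\<Sum>i\<in>A - B. W (A - {i}) * W (B \<union> {i})) = (\<Sum>i\<in>A - B - {j}. W (A - {i}) * W (B \<union> {i}))"
      using rel A B \<open>card B + 1 = d\<close> unfolding exchange_relations_def by blast
    then show ?thesis by (rule sym)
  qed simp
  then show ?thesis using eval[of "{j}"] eval[of "{}"] by simp
next
  case False
  have "finite B" using B by (rule finite_subset) simp
  then have "Wd (insert i B) = 0" if "i \<in> {1..n} - B" for i
    using that False by (simp add: Wd_def)
  then show ?thesis unfolding pairing_def by (intro sum.cong) auto
qed

text \<open>
  Both the pairing and the omission of a term are linear, so it is enough to treat the circuits, of
  which all pulled back forms are combinations.
\<close>

lemma pairing_Qc:
  assumes rel: "exchange_relations n d W W" and B: "B \<subseteq> {1..n}" and "(f, f') \<in> Qc"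
  shows "pairing n Wd (\<lambda>i. f (e i)) B = pairing n Wd (\<lambda>i. f' (e i)) B"
proof -
  interpret D: semimodule "dual V" by (rule semimodule_dual)
  let ?pair = "\<lambda>f. pairing n Wd (\<lambda>i. f (e i)) B"
  let ?R = "{(f, f'). f \<in> carrier (dual V) \<and> f' \<in> carrier (dual V) \<and> ?pair f = ?pair f'}"
  have add: "?pair (f \<oplus>\<^bsub>dual V\<^esub> f') = ?pair f + ?pair f'" for f f'
    unfolding pairing_add[symmetric] by (rule pairing_cong) (simp add: dual_simps basis_closed)
  have smult: "?pair (a \<odot>\<^bsub>dual V\<^esub> f) = a * ?pair f" for a f
    unfolding pairing_smult[symmetric] by (rule pairing_cong) (simp add: dual_simps basis_closed)
  have "equiv (carrier (dual V)) ?R"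
    by (rule equivI) (auto intro!: refl_onI symI transI)
  then have "module_congruence (dual V) ?R"
    by (rule module_congruenceI) (auto simp: add smult)
  moreover have "(pullback h, combination ({1..n} - {j}) (\<lambda>i. pullback h (e i))) \<in> ?R"
    if h: "h \<in> carrier (dual (ext_power V n e (d + 1)))" and j: "j \<in> {1..n}" for h j
  proof -
    let ?h = "\<lambda>A. h (wedge_monomial V n e A)"
    let ?S = "subsets_of_card n (d + 1)"
    have sum: "pairing n Wd (\<lambda>i. \<Sum>A\<in>?S. F A i * ?h A) B = (\<Sum>A\<in>?S. pairing n Wd (F A) B * ?h A)"
      for F :: "nat set \<Rightarrow> nat \<Rightarrow> 's"
      unfolding pairing_def sum_distrib_right
      by (subst sum.swap) (intro sum.cong refl, simp add: mult_ac)
    have "?pair (pullback h) = pairing n Wd (\<lambda>i. \<Sum>A\<in>?S. circuit A i * ?h A) B"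
      by (rule pairing_cong) (rule pullback_expand[OF h])
    also have "\<dots> = (\<Sum>A\<in>?S. pairing n Wd (\<lambda>i. if i = j then 0 else circuit A i) B * ?h A)"
      unfolding sum by (rule sum.cong[OF refl]) (simp only: pairing_circuit[OF rel _ B])
    also have "\<dots> = pairing n Wd (\<lambda>i. \<Sum>A\<in>?S. (if i = j then 0 else circuit A i) * ?h A) B"
      by (rule sum[symmetric])
    also have "\<dots> = ?pair (combination ({1..n} - {j}) (\<lambda>i. pullback h (e i)))"
      by (rule pairing_cong) (simp add: combination_eval pullback_expand[OF h])
    finally show ?thesis using pullback_dual[OF h] combination_dual[of "{1..n} - {j}"] by auto
  qed
  ultimately have "Qc \<subseteq> ?R" unfolding Qc_generators by (intro gen_module_congruence_least) blast+
  then show ?thesis using assms(3) by blast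
qed

text \<open>
  The coefficients of an arbitrary element of a class; its pairing with the Pluecker coordinates is
  independent of the choice when \<open>w\<close> is a Pluecker vector.
\<close>

definition Q_rep :: "('v \<Rightarrow> 's) set \<Rightarrow> nat \<Rightarrow> 's" where
  "Q_rep X i = (SOME f. f \<in> X) (e i)"

lemma pairing_Q_rep:
  assumes rel: "exchange_relations n d W W" and B: "B \<subseteq> {1..n}" and f: "f \<in> carrier (dual V)"
  shows "pairing n Wd (Q_rep (Qc `` {f})) B = pairing n Wd (\<lambda>i. f (e i)) B"
proof -
  have "f \<in> Qc `` {f}" using f module_congruence_equiv[OF Qc_congruence] by (rule equiv_class_self[rotated])
  then have "(SOME f'. f' \<in> Qc `` {f}) \<in> Qc `` {f}"
    by (rule someI[of "\<lambda>f'. f' \<in> Qc `` {f}"])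
  then have "(f, SOME f'. f' \<in> Qc `` {f}) \<in> Qc" by simp
  from pairing_Qc[OF rel B this] show ?thesis unfolding Q_rep_def by simp
qed

lemma Q_alternating:
  assumes rel: "exchange_relations n d W W"
  shows "alternating_functional Q n q Q_rep Wd"
proof unfold_locales
  interpret D: semimodule "dual V" by (rule semimodule_dual)
  note rep = pairing_Q_rep[OF rel]
  have classE: "\<exists>f\<in>carrier (dual V). x = Qc `` {f}" if "x \<in> carrier Q" for x
    using that by (auto simp: Q_module_def quotient_by_simps elim!: quotientE)
  fix x y B assume x: "x \<in> carrier Q" and y: "y \<in> carrier Q" and B: "B \<subseteq> {1..n}"
  obtain f f' where f: "f \<in> carrier (dual V)" "x = Qc `` {f}" "f' \<in> carrier (dual V)" "y = Qc `` {f'}"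
    using classE[OF x] classE[OF y] by blast
  have "x \<oplus>\<^bsub>Q\<^esub> y = Qc `` {f \<oplus>\<^bsub>dual V\<^esub> f'}"
    unfolding f Q_module_def using f by (intro quotient_by_add[OF Qc_congruence])
  then have "pairing n Wd (Q_rep (x \<oplus>\<^bsub>Q\<^esub> y)) B = pairing n Wd (\<lambda>i. (f \<oplus>\<^bsub>dual V\<^esub> f') (e i)) B"
    using f by (simp add: rep[OF B])
  also have "\<dots> = pairing n Wd (\<lambda>i. f (e i) + f' (e i)) B"
    by (rule pairing_cong) (simp add: dual_simps basis_closed)
  finally show "pairing n Wd (Q_rep (x \<oplus>\<^bsub>Q\<^esub> y)) B
      = pairing n Wd (Q_rep x) B + pairing n Wd (Q_rep y) B"
    using f by (simp add: rep[OF B] pairing_add)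
next
  interpret D: semimodule "dual V" by (rule semimodule_dual)
  note rep = pairing_Q_rep[OF rel]
  fix x B a assume x: "x \<in> carrier Q" and B: "B \<subseteq> {1..n}"
  obtain f where f: "f \<in> carrier (dual V)" "x = Qc `` {f}"
    using x by (auto simp: Q_module_def quotient_by_simps elim!: quotientE)
  have "a \<odot>\<^bsub>Q\<^esub> x = Qc `` {a \<odot>\<^bsub>dual V\<^esub> f}"
    unfolding f Q_module_def using f by (intro quotient_by_smult[OF Qc_congruence])
  then have "pairing n Wd (Q_rep (a \<odot>\<^bsub>Q\<^esub> x)) B = pairing n Wd (\<lambda>i. (a \<odot>\<^bsub>dual V\<^esub> f) (e i)) B"
    using f by (simp add: rep[OF B])
  also have "\<dots> = pairing n Wd (\<lambda>i. a * f (e i)) B"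
    by (rule pairing_cong) (simp add: dual_simps basis_closed)
  finally show "pairing n Wd (Q_rep (a \<odot>\<^bsub>Q\<^esub> x)) B = a * pairing n Wd (Q_rep x) B"
    using f by (simp add: rep[OF B] pairing_smult)
next
  fix i B assume i: "i \<in> {1..n}" and B: "B \<subseteq> {1..n}"
  have "pairing n Wd (Q_rep (q i)) B = pairing n Wd (\<lambda>j. dual_basis V n e i (e j)) B"
    unfolding Q_gen_def by (rule pairing_Q_rep[OF rel B dual_basis_dual[OF i]])
  also have "\<dots> = pairing n Wd (\<lambda>j. if j = i then 1 else 0) B"
    by (rule pairing_cong) (simp only: dual_basis_eval[OF i] eq_commute[of i])
  finally show "pairing n Wd (Q_rep (q i)) B = (if i \<in> B then 0 else Wd (insert i B))"
    by (simp only: pairing_var[OF i])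
qed

section \<open>The Pluecker relations and freeness of rank one\<close>

abbreviation E :: "('s, (('v \<Rightarrow> 's) set multiset \<Rightarrow>\<^sub>0 's) set set) module" where
  "E \<equiv> ext_power Q n q d"

lemma Q_homogeneous_expand:
  assumes "p \<in> homogeneous Q d"
  obtains a where "p \<approx>\<^sub>Q (\<Sum>I\<in>subsets_of_card n d. Poly_Mapping.single 0 (a I) * Q.gmono I)"
  using Q.homogeneous_in_span[OF Q_span assms] that by (auto simp: Q.in_span_def)

text \<open>
  For a set \<open>I\<close> in the support of \<open>w\<close>, the class of the monomial of \<open>I\<close> divided by \<open>W I\<close> spans,
  because all squarefree monomials are proportional to it, and it is free, because the functional
  given by \<open>w\<close> takes the value \<open>1\<close> on it.
\<close>

lemma free_if_exchange_relations:
  assumes rel: "exchange_relations n d W W"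
  shows "free_of_rank E 1"
proof -
  interpret E: semimodule E by (rule Q.semimodule_ext_power)
  interpret F: alternating_functional Q n q Q_rep Wd by (rule Q_alternating[OF rel])
  obtain I where I: "I \<in> subsets_of_card n d" "W I \<noteq> 0" by (rule W_nonzero)
  obtain t where t: "W I * t = 1" using ex_mult_inverse[OF I(2)] by blast
  define b where "b = Poly_Mapping.single 0 t * Q.gmono I"
  have b: "b \<in> homogeneous Q d" using I unfolding b_def by (intro homogeneous_smult Q.gmono_subsets_of_card)
  then have pb: "Q.proj b \<in> carrier E" by (rule Q.proj_homogeneous)
  have Fb: "F.functional b = 1"
    using I t F.functional_gmono[of I] by (simp add: b_def F.functional_smult Wd_def mult.commute)
  have multiple: "\<exists>s. Poly_Mapping.single 0 a * Q.gmono J \<approx>\<^sub>Q Poly_Mapping.single 0 s * b"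
    if J: "J \<in> subsets_of_card n d" for J a
  proof -
    let ?c = "\<lambda>s. Poly_Mapping.single 0 s :: ('v \<Rightarrow> 's) set multiset \<Rightarrow>\<^sub>0 's"
    have c: "?c x * (?c y * r) = ?c (x * y) * r" for x y r by (simp add: mult_single flip: mult.assoc)
    have "?c (a * t) * (?c (W I) * Q.gmono J) \<approx>\<^sub>Q ?c (a * t) * (?c (W J) * Q.gmono I)"
      by (rule Q.geq_const_mult[OF Q.gmono_proportional[OF rel I J]])
    moreover have "a * t * W I = a" "a * t * W J = (a * W J) * t"
      using t by (simp_all add: mult_ac)
    ultimately have "?c a * Q.gmono J \<approx>\<^sub>Q ?c (a * W J) * b"
      unfolding b_def c by simp
    then show ?thesis by blast
  qed
  have "\<exists>s. p \<approx>\<^sub>Q Poly_Mapping.single 0 s * b" if p: "p \<in> homogeneous Q d" for p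
  proof -
    obtain a where a: "p \<approx>\<^sub>Q (\<Sum>J\<in>subsets_of_card n d. Poly_Mapping.single 0 (a J) * Q.gmono J)"
      using Q_homogeneous_expand[OF p] .
    have "\<forall>J\<in>subsets_of_card n d. \<exists>s.
        Poly_Mapping.single 0 (a J) * Q.gmono J \<approx>\<^sub>Q Poly_Mapping.single 0 s * b"
      by (intro ballI multiple)
    from bchoice[OF this] obtain s where s: "\<And>J. J \<in> subsets_of_card n d \<Longrightarrow>
        Poly_Mapping.single 0 (a J) * Q.gmono J \<approx>\<^sub>Q Poly_Mapping.single 0 (s J) * b"
      by blast
    have "p \<approx>\<^sub>Q (\<Sum>J\<in>subsets_of_card n d. Poly_Mapping.single 0 (s J) * b)"
      by (rule Q.geq_trans[OF a Q.geq_sum[OF s]])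
    also have "(\<Sum>J\<in>subsets_of_card n d. Poly_Mapping.single 0 (s J) * b)
        = Poly_Mapping.single 0 (\<Sum>J\<in>subsets_of_card n d. s J) * b"
    proof -
      have "(Poly_Mapping.single 0 (sum s X) :: ('v \<Rightarrow> 's) set multiset \<Rightarrow>\<^sub>0 's) = (\<Sum>J\<in>X. Poly_Mapping.single 0 (s J))" for X
        by (induction X rule: infinite_finite_induct) (auto simp: single_add)
      then show ?thesis by (simp add: sum_distrib_right)
    qed
    finally show ?thesis by blast
  qed
  then have span: "\<exists>s. x = s \<odot>\<^bsub>E\<^esub> Q.proj b" if "x \<in> carrier E" for x
    using that b by (fastforce simp: Q.ext_power_carrier Q.geq_def Q.proj_smult homogeneous_carrier)
  have inj: "s = s'" if "s \<odot>\<^bsub>E\<^esub> Q.proj b = s' \<odot>\<^bsub>E\<^esub> Q.proj b" for s s'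
  proof -
    have "Poly_Mapping.single 0 s * b \<approx>\<^sub>Q Poly_Mapping.single 0 s' * b"
      using that b by (auto simp: Q.geq_def Q.proj_smult homogeneous_carrier homogeneous_smult)
    from F.functional_cong[OF this] show ?thesis by (simp add: F.functional_smult Fb)
  qed
  have sum1: "(\<Oplus>\<^bsub>E\<^esub>i\<in>{1..1}. c i \<odot>\<^bsub>E\<^esub> Q.proj b) = c 1 \<odot>\<^bsub>E\<^esub> Q.proj b" for c :: "nat \<Rightarrow> 's"
    using pb E.smult_closed[OF pb] by (simp del: Q.ext_power_simps)
  have "finite_basis E {1..1::nat} (\<lambda>_. Q.proj b)"
    unfolding finite_basis_def sum1
  proof (intro conjI ballI)
    fix x assume "x \<in> carrier E"
    then obtain s where s: "x = s \<odot>\<^bsub>E\<^esub> Q.proj b" using span by blast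
    show "\<exists>!c. c \<in> extensional {1..1::nat} \<and> x = c 1 \<odot>\<^bsub>E\<^esub> Q.proj b"
    proof (rule ex1I[of _ "\<lambda>i\<in>{1..1::nat}. s"])
      show "(\<lambda>i\<in>{1..1::nat}. s) \<in> extensional {1..1} \<and> x = (\<lambda>i\<in>{1..1::nat}. s) 1 \<odot>\<^bsub>E\<^esub> Q.proj b"
        using s by simp
      fix c :: "nat \<Rightarrow> 's" assume c: "c \<in> extensional {1..1} \<and> x = c 1 \<odot>\<^bsub>E\<^esub> Q.proj b"
      then have "c 1 = s" using s inj by metis
      then show "c = (\<lambda>i\<in>{1..1::nat}. s)" using c
        by (intro extensionalityI[of _ "{1..1}"]) auto
    qed
  qed (use pb in auto)
  then show ?thesis unfolding free_of_rank_def using E.semimodule_axioms by blast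
qed

text \<open>
  The coordinate with respect to a basis is a nonzero linear functional.
\<close>

lemma exchange_relations_if_free:
  assumes "free_of_rank E 1"
  shows "exchange_relations n d W W"
proof -
  obtain b where "finite_basis E {1..1::nat} b" using assms unfolding free_of_rank_def by blast
  then interpret E: based_semimodule E "{1..1::nat}" b
    by (intro based_semimodule.intro Q.semimodule_ext_power based_semimodule_axioms.intro)
  define h where "h p = E.coord (Q.proj p) 1" for p
  have one: "(1::nat) \<in> {1..1}" by simp
  have cong: "h p = h p'" if "p \<approx>\<^sub>Q p'" for p p' using that by (simp add: h_def Q.geq_def)
  have add: "h (p + p') = h p + h p'" if "p \<in> homogeneous Q d" "p' \<in> homogeneous Q d" for p p'
    using E.coord_add[OF Q.proj_homogeneous[OF that(1)] Q.proj_homogeneous[OF that(2)] one] that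
    by (simp add: h_def Q.proj_add homogeneous_carrier)
  have smult: "h (Poly_Mapping.single 0 a * p) = a * h p" if "p \<in> homogeneous Q d" for a p
    using E.coord_smult[OF Q.proj_homogeneous[OF that] one] that
    by (simp add: h_def Q.proj_smult homogeneous_carrier)
  obtain I where I: "I \<in> subsets_of_card n d" "W I \<noteq> 0" by (rule W_nonzero)
  have "\<exists>J\<in>subsets_of_card n d. h (Q.gmono J) \<noteq> 0"
  proof (rule ccontr)
    assume neg: "\<not> ?thesis"
    have zero: "h 0 = 0" using smult[of 0 0] by simp
    have "h (\<Sum>J\<in>X. Poly_Mapping.single 0 (a J) * Q.gmono J) = 0" if "X \<subseteq> subsets_of_card n d" for X a
      using that
    proof (induction X rule: infinite_finite_induct)
      case (insert J X)
      have J: "Q.gmono J \<in> homogeneous Q d" using insert.prems by (intro Q.gmono_subsets_of_card) blast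
      have "(\<Sum>J\<in>X. Poly_Mapping.single 0 (a J) * Q.gmono J) \<in> homogeneous Q d"
        using insert.prems by (intro homogeneous_sum homogeneous_smult Q.gmono_subsets_of_card) blast
      then show ?case using insert neg smult[OF J] add[OF homogeneous_smult[OF J]] by simp
    qed (simp_all add: zero)
    moreover obtain p where p: "p \<in> homogeneous Q d" "b 1 = Q.proj p"
      using E.basis_closed[OF one] by (auto simp: Q.ext_power_carrier)
    moreover obtain a where "p \<approx>\<^sub>Q (\<Sum>J\<in>subsets_of_card n d. Poly_Mapping.single 0 (a J) * Q.gmono J)"
      using Q_homogeneous_expand[OF p(1)] .
    ultimately have "h p = 0" using cong by simp
    then show False using E.coord_basis[OF one one] p(2) by (simp add: h_def)
  qed
  then obtain J where "J \<in> subsets_of_card n d" "h (Q.gmono J) \<noteq> 0" by blast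
  then show ?thesis using I by (intro Q.exchange_relations_if_functional[of h J I] cong add smult)
qed

end

theorem theorem6p1p1:
  fixes V :: "('s::idempotent_semifield, 'v) module"
    and e :: "nat \<Rightarrow> 'v"
    and n d :: nat
    and w :: "('v multiset \<Rightarrow>\<^sub>0 's) set set"
  assumes "semimodule V"
    and "finite_basis V {1..n} e"
    and "w \<in> carrier (ext_power V n e d)"
    and "w \<noteq> \<zero>\<^bsub>ext_power V n e d\<^esub>"
  shows "tropical_pluecker_vector V n e d w \<longleftrightarrow>
    free_of_rank (ext_power (Q_module V n e d w) n (Q_gen V n e d w) d) 1"
proof -
  interpret tropical_vector V n e d w
    by (intro tropical_vector.intro free_semimodule.intro based_semimodule.intro
        based_semimodule_axioms.intro tropical_vector_axioms.intro assms)
  have "tropical_pluecker_vector V n e d w \<longleftrightarrow> exchange_relations n d W W"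
    unfolding tropical_pluecker_vector_def exchange_relations_def using assms(3,4) by blast
  then show ?thesis using free_if_exchange_relations exchange_relations_if_free by blast
qed

end
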